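(* For every integer $n\ge 2$, $$\frac12\log_2\left(\left[\frac n2\right]+1\right)\le w_2(n)\le \frac12[\log_2 n]+\frac54 .$$ In particular, $$\lim_{n\to\infty}\frac{w_2(n)}{\log_2 n}=\frac12 .$$
   Context: $[t]$ denotes the integer part of the real number $t$. For a nonempty closed bounded set $K\subset\mathbb R^n$, $C(K)$ is the space of continuous real-valued functions on $K$. For $f\in C(K)$ and $m\ge1$, let $E_m(f;K)=\inf_{\varphi}\max_{x\in K}|f(x)-\varphi(x)|$, the infimum over all real polynomials $\varphi$ on $\mathbb R^n$ of total degree at most $m-1$; let $\Delta_h^m(f;x)=\sum_{j=0}^m(-1)^{m-j}\binom mj f(x+jh)$ and $\omega_m(f;K)=\sup|\Delta_h^m(f;x)|$, the supremum over all $x,h\in\mathbb R^n$ such that $x,x+h,\dots,x+mh\in K$. The Whitney constant of $K$ is $w_m(K)=\sup\{E_m(f;K): f\in C(K),\ \omega_m(f;K)\le 1\}$. The global Whitney constant is $w_m(n)=\sup w_m(K)$, the supremum over all (nonempty) closed bounded convex subsets $K$ of $\mathbb R^n$. *)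

theory Defs
  imports "HOL-Analysis.Analysis"
begin

text \<open>
  Since the dimension \<open>n\<close> has to vary inside the statement, \<open>\<real>\<^sup>n\<close> is rendered as the library's
  \<open>Euclidean_space n\<close>: the points are the functions \<open>x :: nat \<Rightarrow> real\<close> with \<open>x i = 0\<close> for
  \<open>i \<ge> n\<close>, with the usual topology. Vector operations are written out coordinatewise.

  Suprema and infima are taken in the complete lattice \<open>ereal\<close>, so that no boundedness has
  to be presupposed.
\<close>

definition bounded_in :: "nat \<Rightarrow> (nat \<Rightarrow> real) set \<Rightarrow> bool" where
  "bounded_in n K \<longleftrightarrow> K \<subseteq> topspace (Euclidean_space n) \<and> (\<exists>B. \<forall>x\<in>K. L2_set x {..<n} \<le> B)"

definition convex_in :: "nat \<Rightarrow> (nat \<Rightarrow> real) set \<Rightarrow> bool" where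
  "convex_in n K \<longleftrightarrow> K \<subseteq> topspace (Euclidean_space n) \<and>
     (\<forall>x\<in>K. \<forall>y\<in>K. \<forall>u\<ge>0. \<forall>v\<ge>0. u + v = 1 \<longrightarrow> (\<lambda>i. u * x i + v * y i) \<in> K)"

definition multi_indices :: "nat \<Rightarrow> nat \<Rightarrow> (nat \<Rightarrow> nat) set" where
  "multi_indices n d = {\<alpha>. (\<forall>i\<ge>n. \<alpha> i = 0) \<and> (\<Sum>i<n. \<alpha> i) \<le> d}"

lemma finite_multi_indices: "finite (multi_indices n d)"
proof (rule finite_subset)
  show "multi_indices n d \<subseteq> {\<alpha>. \<forall>i. (i \<in> {..<n} \<longrightarrow> \<alpha> i \<in> {..d}) \<and> (i \<notin> {..<n} \<longrightarrow> \<alpha> i = 0)}"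
  proof clarsimp
    fix \<alpha> i assume a: "\<alpha> \<in> multi_indices n d"
    have "\<alpha> i \<le> (\<Sum>i<n. \<alpha> i)" if "i < n"
      using that by (intro member_le_sum) auto
    with a show "(i < n \<longrightarrow> \<alpha> i \<le> d) \<and> (\<not> i < n \<longrightarrow> \<alpha> i = 0)"
      by (auto simp: multi_indices_def)
  qed
qed (rule finite_set_of_finite_funs; simp)

text \<open>Polynomial functions on \<open>\<real>\<^sup>n\<close> of total degree at most \<open>d\<close>.\<close>

definition polynomials :: "nat \<Rightarrow> nat \<Rightarrow> ((nat \<Rightarrow> real) \<Rightarrow> real) set" where
  "polynomials n d =
     {\<phi>. \<exists>c. \<forall>x. \<phi> x = (\<Sum>\<alpha>\<in>multi_indices n d. c \<alpha> * (\<Prod>i<n. x i ^ \<alpha> i))}"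

text \<open>
  The functions \<open>f\<close> below are total, but only their values on \<open>K\<close> matter. The inner supremum
  in \<open>best_approx\<close> is a maximum when \<open>K\<close> is nonempty and compact and \<open>f\<close> is continuous on \<open>K\<close>.
  The intended range of \<open>m\<close> is \<open>m \<ge> 1\<close>.
\<close>

definition best_approx ::
    "nat \<Rightarrow> nat \<Rightarrow> ((nat \<Rightarrow> real) \<Rightarrow> real) \<Rightarrow> (nat \<Rightarrow> real) set \<Rightarrow> ereal" where
  "best_approx n m f K = (INF \<phi>\<in>polynomials n (m - 1). SUP x\<in>K. ereal \<bar>f x - \<phi> x\<bar>)"

definition fin_diff ::
    "nat \<Rightarrow> (nat \<Rightarrow> real) \<Rightarrow> ((nat \<Rightarrow> real) \<Rightarrow> real) \<Rightarrow> (nat \<Rightarrow> real) \<Rightarrow> real" where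
  "fin_diff m h f x =
     (\<Sum>j=0..m. (-1) ^ (m - j) * real (m choose j) * f (\<lambda>i. x i + real j * h i))"

definition modulus ::
    "nat \<Rightarrow> nat \<Rightarrow> ((nat \<Rightarrow> real) \<Rightarrow> real) \<Rightarrow> (nat \<Rightarrow> real) set \<Rightarrow> ereal" where
  "modulus n m f K =
     (SUP (x, h) \<in> {(x, h). x \<in> topspace (Euclidean_space n) \<and> h \<in> topspace (Euclidean_space n) \<and>
                            (\<forall>j\<le>m. (\<lambda>i. x i + real j * h i) \<in> K)}.
        ereal \<bar>fin_diff m h f x\<bar>)"

definition whitney_const_on :: "nat \<Rightarrow> nat \<Rightarrow> (nat \<Rightarrow> real) set \<Rightarrow> ereal" where
  "whitney_const_on n m K =
     (SUP f \<in> {f. continuous_map (subtopology (Euclidean_space n) K) euclideanreal f \<and>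
                  modulus n m f K \<le> 1}.
        best_approx n m f K)"

definition whitney_const :: "nat \<Rightarrow> nat \<Rightarrow> ereal" where
  "whitney_const m n =
     (SUP K \<in> {K. K \<noteq> {} \<and> closedin (Euclidean_space n) K \<and> bounded_in n K \<and> convex_in n K}.
        whitney_const_on n m K)"

end

theory Submission
  imports Defs "HOL-Real_Asymp.Real_Asymp"
begin

text \<open>
  Let \<open>f\<close> be continuous on a convex body \<open>K\<close> with second modulus at most \<open>1\<close>, that is,
  \<open>f ((x + y) / 2)\<close> differs from \<open>(f x + f y) / 2\<close> by at most \<open>1/2\<close>.

  For the upper bound, the distance of \<open>f\<close> from the affine functions is governed by convex
  separation: it is at most \<open>M\<close> as soon as no convex combination of values of \<open>f\<close> exceeds another
  one with (nearly) the same barycentre by \<open>2 * M\<close> (\<open>best_approx_upper\<close>). By an affine dependence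
  argument only pairs with at most \<open>n + 2\<close> points in total have to be considered
  (\<open>reduce_support\<close>). The Jensen defect of \<open>f\<close> on \<open>r + 1\<close> points is at most
  \<open>1 + 1/2 * log 2 r\<close> for \<open>r \<ge> 1\<close> and \<open>0\<close> for \<open>r = 0\<close> (\<open>jensen_defect\<close>): a barycentre is the
  midpoint of two barycentres whose point sets share at most one point, so the halving of the
  weights also splits \<open>r\<close> into \<open>s + t\<close>, at a cost of \<open>1/2\<close>, and the bound is compatible with this
  recursion by the inequality of arithmetic and geometric means. If two
  point sets with \<open>a + 1\<close> and \<open>b + 1\<close> elements satisfy \<open>a + b \<le> n\<close>, the two defects add up to at
  most \<open>1 + log 2 n\<close>. This yields \<open>1/2 * log 2 n + 1/2\<close> as an upper bound, which is at most
  \<open>1/2 * \<lfloor>log 2 n\<rfloor> + 1\<close>.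

  For the lower bound, let \<open>m\<close> be the integer part of \<open>n / 2\<close>, let \<open>K\<close> be the product of two \<open>m\<close>-dimensional
  simplices, and let \<open>f\<close> be half the difference of the Shannon entropies of the two factors,
  measured in bits. The Jensen--Shannon divergence lies between \<open>0\<close> and \<open>1\<close>
  (\<open>entropy_midpoint\<close>), so the second modulus of \<open>f\<close> is at most \<open>1\<close>. On the pairs of the centre
  and a vertex, \<open>f\<close> equals \<open>1/2 * log 2 (m + 1)\<close>, on the pairs of a vertex and the centre it is
  the negative of that number; both families have the same average point, so no affine function
  approximates \<open>f\<close> better than that (\<open>whitney_const_lower\<close>).
\<close>

section \<open>Affine polynomials and the second modulus\<close>

lemma multi_indices_1:
  "multi_indices n 1 = insert (\<lambda>_. 0) ((\<lambda>i j. if j = i then 1 else 0) ` {..<n})" (is "?L = ?R")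
proof
  show "?L \<subseteq> ?R"
  proof
    fix \<alpha> assume a: "\<alpha> \<in> ?L"
    hence z: "\<And>i. i \<ge> n \<Longrightarrow> \<alpha> i = 0" and s: "(\<Sum>i<n. \<alpha> i) \<le> 1"
      by (auto simp: multi_indices_def)
    show "\<alpha> \<in> ?R"
    proof (cases "\<exists>i<n. \<alpha> i \<noteq> 0")
      case False
      hence "\<alpha> = (\<lambda>_. 0)" using z by (intro ext) (metis not_less)
      thus ?thesis by simp
    next
      case True
      then obtain i where i: "i < n" "\<alpha> i \<noteq> 0" by blast
      have "(\<Sum>i<n. \<alpha> i) = \<alpha> i + (\<Sum>j\<in>{..<n} - {i}. \<alpha> j)"
        using i by (intro sum.remove) auto
      with s i have 1: "\<alpha> i = 1" and "(\<Sum>j\<in>{..<n} - {i}. \<alpha> j) = 0" by linarith+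
      hence "\<And>j. j < n \<Longrightarrow> j \<noteq> i \<Longrightarrow> \<alpha> j = 0" by simp
      hence "\<alpha> = (\<lambda>j. if j = i then 1 else 0)"
        using z 1 by (intro ext) (metis not_less)
      thus ?thesis using i by blast
    qed
  qed
  show "?R \<subseteq> ?L"
    by (auto simp: multi_indices_def)
qed

lemma sum_multi_indices_1:
  "(\<Sum>\<alpha>\<in>multi_indices n 1. c \<alpha> * (\<Prod>i<n. x i ^ \<alpha> i)) =
     c (\<lambda>_. 0) + (\<Sum>i<n. c (\<lambda>j. if j = i then 1 else 0) * (x i :: real))"
proof -
  let ?e = "\<lambda>(i::nat) j. if j = i then 1 else 0 :: nat"
  have inj: "inj_on ?e {..<n}"
    by (rule inj_onI) (metis zero_neq_one)
  have ne: "(\<lambda>_. 0) \<noteq> ?e i" for i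
    by (metis zero_neq_one)
  have "(\<lambda>_. 0) \<notin> ?e ` {..<n}"
  proof
    assume "(\<lambda>_. 0) \<in> ?e ` {..<n}"
    thus False by (rule imageE) (use ne in blast)
  qed
  hence "(\<Sum>\<alpha>\<in>multi_indices n 1. c \<alpha> * (\<Prod>i<n. x i ^ \<alpha> i)) =
      c (\<lambda>_. 0) + (\<Sum>i<n. c (?e i) * (\<Prod>j<n. x j ^ ?e i j))"
    unfolding multi_indices_1 by (simp add: sum.reindex[OF inj])
  also have "(\<Prod>j<n. x j ^ ?e i j) = x i" if "i < n" for i
  proof -
    have "(\<Prod>j<n. x j ^ ?e i j) = (\<Prod>j<n. if j = i then x j else 1)"
      by (intro prod.cong) auto
    thus ?thesis using that by (simp add: prod.delta)
  qed
  hence "(\<Sum>i<n. c (?e i) * (\<Prod>j<n. x j ^ ?e i j)) = (\<Sum>i<n. c (?e i) * x i)"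
    by (intro sum.cong) auto
  finally show ?thesis .
qed

lemma polynomials_1_iff:
  "\<phi> \<in> polynomials n 1 \<longleftrightarrow> (\<exists>c a. \<forall>x. \<phi> x = c + (\<Sum>i<n. a i * x i))"
proof
  assume "\<phi> \<in> polynomials n 1"
  then obtain c where "\<And>x. \<phi> x = (\<Sum>\<alpha>\<in>multi_indices n 1. c \<alpha> * (\<Prod>i<n. x i ^ \<alpha> i))"
    by (auto simp: polynomials_def)
  thus "\<exists>c a. \<forall>x. \<phi> x = c + (\<Sum>i<n. a i * x i)"
    unfolding sum_multi_indices_1
    by (intro exI[of _ "c (\<lambda>_. 0)"] exI[of _ "\<lambda>i. c (\<lambda>j. if j = i then 1 else 0)"]) simp
next
  assume "\<exists>c a. \<forall>x. \<phi> x = c + (\<Sum>i<n. a i * x i)"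
  then obtain c a where \<phi>: "\<And>x. \<phi> x = c + (\<Sum>i<n. a i * x i)" by blast
  define c' where "c' \<alpha> = (if \<alpha> = (\<lambda>_. 0) then c else \<Sum>j<n. a j * real (\<alpha> j))" for \<alpha> :: "nat \<Rightarrow> nat"
  have "c' (\<lambda>j. if j = i then 1 else 0) = a i" if "i < n" for i
  proof -
    have "(\<lambda>j. if j = i then 1 else 0 :: nat) \<noteq> (\<lambda>_. 0)" by (metis zero_neq_one)
    hence "c' (\<lambda>j. if j = i then 1 else 0) = (\<Sum>j<n. if j = i then a j else 0)"
      unfolding c'_def by (simp add: if_distrib cong: if_cong)
    thus ?thesis using that by simp
  qed
  hence "\<phi> x = (\<Sum>\<alpha>\<in>multi_indices n 1. c' \<alpha> * (\<Prod>i<n. x i ^ \<alpha> i))" for x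
    unfolding sum_multi_indices_1 \<phi> by (simp add: c'_def)
  thus "\<phi> \<in> polynomials n 1" unfolding polynomials_def by blast
qed

lemma convex_inD:
  assumes "convex_in n K" "x \<in> K" "y \<in> K" "u \<ge> 0" "v \<ge> 0" "u + v = 1"
  shows "(\<lambda>i. u * x i + v * y i) \<in> K"
  using assms(1)[unfolded convex_in_def, THEN conjunct2, rule_format, OF assms(2-)] .

text \<open>
  Writing a second difference through the endpoints \<open>x\<close> and \<open>y = x + 2h\<close> of its segment turns
  the modulus into a statement about midpoints; convexity of \<open>K\<close> makes the midpoint
  automatically admissible.
\<close>

lemma modulus_2_le_iff:
  assumes "convex_in n K"
  shows "modulus n 2 f K \<le> ereal \<delta> \<longleftrightarrow>
    (\<forall>x\<in>K. \<forall>y\<in>K. \<bar>f x + f y - 2 * f (\<lambda>i. (x i + y i) / 2)\<bar> \<le> \<delta>)"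
proof -
  have fd: "fin_diff 2 h f x = f x + f (\<lambda>i. x i + 2 * h i) - 2 * f (\<lambda>i. x i + h i)" for h x
    by (simp add: fin_diff_def numeral_2_eq_2)
  have K: "K \<subseteq> topspace (Euclidean_space n)" using assms by (auto simp: convex_in_def)
  have "modulus n 2 f K \<le> ereal \<delta> \<longleftrightarrow>
      (\<forall>x h. x \<in> topspace (Euclidean_space n) \<longrightarrow> h \<in> topspace (Euclidean_space n) \<longrightarrow>
         (\<forall>j\<le>2. (\<lambda>i. x i + real j * h i) \<in> K) \<longrightarrow> \<bar>fin_diff 2 h f x\<bar> \<le> \<delta>)"
    unfolding modulus_def by (auto simp: SUP_le_iff)
  also have "\<dots> \<longleftrightarrow> (\<forall>x\<in>K. \<forall>y\<in>K. \<bar>f x + f y - 2 * f (\<lambda>i. (x i + y i) / 2)\<bar> \<le> \<delta>)" (is "?l \<longleftrightarrow> ?r")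
  proof
    assume l: ?l
    show ?r
    proof (intro ballI)
      fix x y assume x: "x \<in> K" and y: "y \<in> K"
      define h where "h = (\<lambda>i. (y i - x i) / 2)"
      have y': "(\<lambda>i. x i + 2 * h i) = y" by (intro ext) (simp add: h_def field_simps)
      have m: "(\<lambda>i. x i + h i) = (\<lambda>i. (x i + y i) / 2)" by (intro ext) (simp add: h_def field_simps)
      have "(\<lambda>i. (1/2) * x i + (1/2) * y i) \<in> K"
        by (rule convex_inD[OF assms x y]) auto
      hence mK: "(\<lambda>i. (x i + y i) / 2) \<in> K" by (simp add: add_divide_distrib)
      have "(\<lambda>i. x i + real j * h i) \<in> K" if "j \<le> 2" for j
      proof -
        consider "j = 0" | "j = 1" | "j = 2" using \<open>j \<le> 2\<close> by linarith
        thus ?thesis using x y mK y' m by cases auto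
      qed
      moreover have "x \<in> topspace (Euclidean_space n)" "h \<in> topspace (Euclidean_space n)"
        using subsetD[OF K x] subsetD[OF K y] by (auto simp: h_def topspace_Euclidean_space)
      ultimately have "\<bar>fin_diff 2 h f x\<bar> \<le> \<delta>" using l by blast
      thus "\<bar>f x + f y - 2 * f (\<lambda>i. (x i + y i) / 2)\<bar> \<le> \<delta>" by (simp add: fd y' m)
    qed
  next
    assume r: ?r
    show ?l
    proof (intro allI impI)
      fix x h assume *: "\<forall>j\<le>2. (\<lambda>i. x i + real j * h i) \<in> K"
      have "x \<in> K" using *[rule_format, of 0] by simp
      moreover have "(\<lambda>i. x i + 2 * h i) \<in> K" using *[rule_format, of 2] by simp
      ultimately have "\<bar>f x + f (\<lambda>i. x i + 2 * h i) - 2 * f (\<lambda>i. (x i + (x i + 2 * h i)) / 2)\<bar> \<le> \<delta>"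
        using r by blast
      thus "\<bar>fin_diff 2 h f x\<bar> \<le> \<delta>" unfolding fd by (simp add: add_divide_distrib)
    qed
  qed
  finally show ?thesis .
qed

section \<open>Compactness and uniform continuity\<close>

text \<open>
  The product topology on \<^typ>\<open>nat \<Rightarrow> real\<close> is the topology of the type class instance, which is
  metrizable. This makes the metric theory of compactness and uniform continuity applicable
  although the dimension is a variable.
\<close>

lemma Euclidean_space_eq_subtopology:
  "Euclidean_space n = top_of_set (topspace (Euclidean_space n))"
  unfolding topspace_Euclidean_space unfolding Euclidean_space_def euclidean_product_topology ..

lemma closed_topspace_Euclidean_space: "closed (topspace (Euclidean_space n))"
proof -
  have "topspace (Euclidean_space n) = (\<Inter>i\<in>{n..}. {x :: nat \<Rightarrow> real. x i = 0})"
    by (auto simp: topspace_Euclidean_space)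
  moreover have "closed {x :: nat \<Rightarrow> real. x i = 0}" for i
    by (intro closed_Collect_eq continuous_on_const) (simp add: continuous_on_product_coordinates)
  ultimately show ?thesis by (simp add: closed_INT)
qed

lemma continuous_map_Euclidean_space_iff:
  assumes "K \<subseteq> topspace (Euclidean_space n)"
  shows "continuous_map (subtopology (Euclidean_space n) K) euclideanreal f \<longleftrightarrow> continuous_on K f"
proof -
  have "subtopology (Euclidean_space n) K = top_of_set K"
    using assms
    by (subst Euclidean_space_eq_subtopology) (simp add: subtopology_subtopology Int_absorb1)
  thus ?thesis by simp
qed

lemma closedin_Euclidean_space_iff:
  assumes "K \<subseteq> topspace (Euclidean_space n)"
  shows "closedin (Euclidean_space n) K \<longleftrightarrow> closed K"
  using assms closed_topspace_Euclidean_space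
  by (subst Euclidean_space_eq_subtopology) (auto intro: closed_subset closedin_closed_trans)

lemma bounded_in_coordinates:
  assumes "bounded_in n K"
  obtains B where "\<And>x i. x \<in> K \<Longrightarrow> \<bar>x i\<bar> \<le> B"
proof -
  have K: "K \<subseteq> topspace (Euclidean_space n)" using assms by (auto simp: bounded_in_def)
  obtain B where B: "\<And>x. x \<in> K \<Longrightarrow> L2_set x {..<n} \<le> B" using assms by (auto simp: bounded_in_def)
  have "\<bar>x i\<bar> \<le> \<bar>B\<bar>" if "x \<in> K" for x i
  proof (cases "i < n")
    case True
    hence "\<bar>x i\<bar> \<le> L2_set (\<lambda>i. \<bar>x i\<bar>) {..<n}" by (intro member_le_L2_set) auto
    thus ?thesis using B[OF that] by (simp add: L2_set_def)
  next
    case False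
    thus ?thesis using that K by (auto simp: topspace_Euclidean_space)
  qed
  thus ?thesis by (rule that)
qed

lemma compact_Euclidean_space:
  assumes "closedin (Euclidean_space n) K" "bounded_in n K"
  shows "compact K"
proof -
  have K: "K \<subseteq> topspace (Euclidean_space n)" using assms by (auto simp: bounded_in_def)
  obtain B where B: "\<And>x i. x \<in> K \<Longrightarrow> \<bar>x i\<bar> \<le> B" using bounded_in_coordinates[OF assms(2)] by blast
  have sub: "K \<subseteq> (\<Pi>\<^sub>E i\<in>UNIV. {-B..B})" 
    using B by (auto simp: abs_le_iff minus_le_iff)
  have "compactin (powertop_real UNIV) (\<Pi>\<^sub>E i\<in>UNIV. {-B..B})"
    unfolding compactin_PiE by simp
  hence "compact ((\<Pi>\<^sub>E i\<in>UNIV. {-B..B}) :: (nat \<Rightarrow> real) set)"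
    by (simp add: euclidean_product_topology)
  moreover have "closed K" using assms closedin_Euclidean_space_iff[OF K] by simp
  ultimately show ?thesis using sub by (metis compact_Int_closed inf.absorb2)
qed

text \<open>
  The metric of \<^typ>\<open>nat \<Rightarrow> real\<close> is a weighted combination of all coordinate distances. Points of
  \<open>K\<close> agree from coordinate \<open>n\<close> on, so closeness in the first \<open>n\<close> coordinates bounds it.
\<close>

lemma uniform_continuity_coordinatewise:
  assumes "compact K" "continuous_on K f" "K \<subseteq> topspace (Euclidean_space n)" "\<epsilon> > 0"
  obtains d where "d > 0"
    "\<And>x y. \<lbrakk>x \<in> K; y \<in> K; \<And>i. i < n \<Longrightarrow> \<bar>x i - y i\<bar> < d\<rbrakk> \<Longrightarrow> \<bar>f x - f y :: real\<bar> < \<epsilon>"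
proof -
  have "uniformly_continuous_on K f" using assms by (intro compact_uniformly_continuous)
  then obtain e where e: "e > 0" "\<And>x y. \<lbrakk>x \<in> K; y \<in> K; dist y x < e\<rbrakk> \<Longrightarrow> dist (f y) (f x) < \<epsilon>"
    unfolding uniformly_continuous_on_def using assms(4) by metis
  obtain N where N: "(1/2::real) ^ N < e / 2" using real_arch_pow_inv[of "e/2" "1/2"] e by auto
  have "\<bar>f x - f y\<bar> < \<epsilon>" if xy: "x \<in> K" "y \<in> K" "\<And>i. i < n \<Longrightarrow> \<bar>x i - y i\<bar> < e / 4" for x y
  proof -
    have "dist (x i) (y i) < e / 4" for i
    proof (cases "i < n")
      case True
      thus ?thesis using xy(3) by (simp add: dist_real_def)
    next
      case False
      hence "x i = 0" "y i = 0" using xy(1,2) assms(3) by (auto simp: topspace_Euclidean_space)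
      thus ?thesis using e(1) by simp
    qed
    hence "Max {dist (x (from_nat n)) (y (from_nat n)) |n. n \<le> N} < e / 4"
      by (subst Max_less_iff) auto
    hence "dist x y < e"
      using dist_fun_le_dist_first_terms[of x y N] N by linarith
    thus ?thesis using e(2)[of y x] xy by (simp add: dist_real_def)
  qed
  thus ?thesis using that[of "e / 4"] e(1) by auto
qed

section \<open>Convex combinations of points\<close>

text \<open>
  Weights are functions on the whole type, and the sum runs over their support, so that weights
  with different supports can be added without keeping track of an index set. For infinite
  support the value is \<open>0\<close>; it is only of interest for finite support. Weights may be negative,
  which is needed for the perturbations in the reduction to few points.
\<close>

definition mean :: "('a \<Rightarrow> real) \<Rightarrow> ('a \<Rightarrow> real) \<Rightarrow> real" where
  "mean w g = (\<Sum>x | w x \<noteq> 0. w x * g x)"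

definition barycentre :: "((nat \<Rightarrow> real) \<Rightarrow> real) \<Rightarrow> nat \<Rightarrow> real" where
  "barycentre w = (\<lambda>i. mean w (\<lambda>x. x i))"

definition convex_weights :: "'a set \<Rightarrow> ('a \<Rightarrow> real) \<Rightarrow> bool" where
  "convex_weights K w \<longleftrightarrow>
     (\<forall>x. 0 \<le> w x) \<and> finite {x. w x \<noteq> 0} \<and> {x. w x \<noteq> 0} \<subseteq> K \<and> mean w (\<lambda>_. 1) = 1"

lemma mean_eq_sum:
  assumes "finite S" "{x. w x \<noteq> 0} \<subseteq> S"
  shows "mean w g = (\<Sum>x\<in>S. w x * g x)"
  unfolding mean_def using assms by (intro sum.mono_neutral_left) auto

lemma mean_linear:
  assumes "finite {x. w x \<noteq> 0}" "finite {x. v x \<noteq> 0}"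
  shows "mean (\<lambda>x. s * w x + t * v x) g = s * mean w g + t * mean v g"
proof -
  let ?S = "{x. w x \<noteq> 0} \<union> {x. v x \<noteq> 0}"
  have "mean (\<lambda>x. s * w x + t * v x) g = (\<Sum>x\<in>?S. (s * w x + t * v x) * g x)"
    using assms by (intro mean_eq_sum) auto
  also have "\<dots> = s * (\<Sum>x\<in>?S. w x * g x) + t * (\<Sum>x\<in>?S. v x * g x)"
    by (simp add: sum_distrib_left sum.distrib algebra_simps)
  also have "(\<Sum>x\<in>?S. w x * g x) = mean w g" using assms by (intro mean_eq_sum[symmetric]) auto
  also have "(\<Sum>x\<in>?S. v x * g x) = mean v g" using assms by (intro mean_eq_sum[symmetric]) auto
  finally show ?thesis .
qed

lemma mean_linear_right: "mean w (\<lambda>x. s * g x + t * h x) = s * mean w g + t * mean w h"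
  by (simp add: mean_def sum_distrib_left sum.distrib algebra_simps)

lemma mean_scale: "finite {x. w x \<noteq> 0} \<Longrightarrow> mean (\<lambda>x. c * w x) g = c * mean w g"
  using mean_linear[of w w c 0 g] by simp

lemma convex_weights_mix:
  assumes "convex_weights K w" "convex_weights K v" "s \<ge> 0" "t \<ge> 0" "s + t = 1"
  shows "convex_weights K (\<lambda>x. s * w x + t * v x)"
proof -
  have "{x. s * w x + t * v x \<noteq> 0} \<subseteq> {x. w x \<noteq> 0} \<union> {x. v x \<noteq> 0}" by auto
  thus ?thesis using assms
    unfolding convex_weights_def by (auto simp: mean_linear intro: finite_subset)
qed

lemma mean_bounded:
  assumes "convex_weights K w" "\<And>x. x \<in> K \<Longrightarrow> \<bar>g x\<bar> \<le> B"
  shows "\<bar>mean w g\<bar> \<le> B"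
proof -
  have "\<bar>mean w g\<bar> \<le> (\<Sum>x | w x \<noteq> 0. \<bar>w x * g x\<bar>)" unfolding mean_def by (rule sum_abs)
  also have "\<dots> \<le> (\<Sum>x | w x \<noteq> 0. w x * B)"
    using assms by (intro sum_mono) (auto simp: convex_weights_def abs_mult mult_left_mono)
  also have "\<dots> = B * mean w (\<lambda>_. 1)" by (simp add: mean_def sum_distrib_left mult.commute)
  finally show ?thesis using assms by (simp add: convex_weights_def)
qed

lemma convex_weights_support_card:
  assumes "convex_weights K w"
  shows "card {x. w x \<noteq> 0} \<ge> 1"
proof -
  have "{x. w x \<noteq> 0} \<noteq> {}"
  proof
    assume *: "{x. w x \<noteq> 0} = {}"
    have "mean w (\<lambda>_. 1) = 0" unfolding mean_def * by simp
    thus False using assms by (simp add: convex_weights_def)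
  qed
  thus ?thesis using assms by (simp add: convex_weights_def Suc_le_eq card_gt_0_iff)
qed

lemma convex_weights_singleton:
  assumes "convex_weights K w" "card {x. w x \<noteq> 0} = 1"
  obtains a where "a \<in> K" "\<And>g. mean w g = g a"
proof -
  obtain a where a: "{x. w x \<noteq> 0} = {a}" using assms(2) by (auto simp: card_1_singleton_iff)
  have "mean w g = w a * g a" for g unfolding mean_def a by simp
  moreover from this[of "\<lambda>_. 1"] have "w a = 1" using assms by (simp add: convex_weights_def)
  ultimately show ?thesis using that[of a] a assms(1) by (auto simp: convex_weights_def)
qed

lemma convex_in_sum:
  assumes "convex_in n K" "finite S" "S \<noteq> {}" "S \<subseteq> K" "\<And>x. x \<in> S \<Longrightarrow> w x \<ge> 0" "sum w S = 1"
  shows "(\<lambda>i. \<Sum>x\<in>S. w x * x i) \<in> K"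
  using assms(2-)
proof (induction S arbitrary: w rule: finite_ne_induct)
  case (singleton x)
  thus ?case by simp
next
  case (insert a S)
  have wa: "w a = 1 - sum w S" using insert by simp
  show ?case
  proof (cases "sum w S = 0")
    case True
    hence "\<forall>x\<in>S. w x = 0" using insert by (simp add: sum_nonneg_eq_0_iff)
    moreover have "w a = 1" using wa True by simp
    ultimately show ?thesis using insert by simp
  next
    case False
    define s where "s = sum w S"
    have s: "s > 0" using False insert.prems(2) unfolding s_def
      by (metis insertI2 less_eq_real_def sum_nonneg)
    have "(\<lambda>i. \<Sum>x\<in>S. (w x / s) * x i) \<in> K"
    proof (intro insert.IH)
      show "S \<subseteq> K" using insert.prems by simp
      show "w x / s \<ge> 0" if "x \<in> S" for x using s insert.prems that by simp
      show "(\<Sum>x\<in>S. w x / s) = 1" using s by (simp add: s_def sum_divide_distrib[symmetric])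
    qed
    moreover have "a \<in> K" "w a \<ge> 0" "s \<ge> 0" "w a + s = 1"
    proof -
      show "w a + s = 1" using wa by (simp add: s_def)
    qed (use insert.prems s in auto)
    ultimately have "(\<lambda>i. w a * a i + s * (\<Sum>x\<in>S. (w x / s) * x i)) \<in> K"
      by (intro convex_inD[OF assms(1)])
    also have "(\<lambda>i. w a * a i + s * (\<Sum>x\<in>S. (w x / s) * x i)) = (\<lambda>i. \<Sum>x\<in>insert a S. w x * x i)"
      using insert s by (auto simp: sum_distrib_left)
    finally show ?thesis .
  qed
qed

lemma barycentre_in:
  assumes "convex_in n K" "convex_weights K w"
  shows "barycentre w \<in> K"
proof -
  have "{x. w x \<noteq> 0} \<noteq> {}" using convex_weights_support_card[OF assms(2)] by (metis card.empty not_one_le_zero)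
  thus ?thesis unfolding barycentre_def mean_def
    using assms by (intro convex_in_sum[where n = n]) (auto simp: convex_weights_def mean_def)
qed

section \<open>Jensen's inequality for functions with small second differences\<close>

text \<open>
  Put the points in some order and cut the total weight at height \<open>c\<close>: the points before the cut
  go to \<open>u\<close>, those after it to \<open>v\<close>, and only the single point at which the cut falls is shared.
  Hence the two supports together have at most one point more than the original one. For
  \<open>c = 1/2\<close> this exhibits a barycentre as the midpoint of two barycentres with nearly disjoint
  supports.
\<close>

lemma split_weights:
  assumes "finite S" "\<And>x. w x \<ge> 0" "\<And>x. x \<notin> S \<Longrightarrow> w x = 0" "0 \<le> c" "c \<le> sum w S"
  shows "\<exists>u v. (\<forall>x. u x \<ge> 0 \<and> v x \<ge> 0 \<and> w x = u x + (v x :: real)) \<and> sum u S = c \<and>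
            card {x. u x \<noteq> 0} + card {x. v x \<noteq> 0} \<le> card S + 1"
  using assms
proof (induction S arbitrary: w rule: finite_induct)
  case empty
  have "w = (\<lambda>_. 0)" using empty by auto
  thus ?case using empty by (intro exI[of _ "\<lambda>_. 0"]) auto
next
  case (insert a S)
  define w' where "w' = w(a := 0)"
  have sw': "sum w' S = sum w S" unfolding w'_def using insert by (intro sum.cong) auto
  show ?case
  proof (cases "c \<le> sum w S")
    case True
    obtain u v where uv: "\<And>x. u x \<ge> 0 \<and> v x \<ge> 0 \<and> w' x = u x + (v x :: real)" "sum u S = c"
            "card {x. u x \<noteq> 0} + card {x. v x \<noteq> 0} \<le> card S + 1"
    proof -
      have "\<And>x. w' x \<ge> 0" "\<And>x. x \<notin> S \<Longrightarrow> w' x = 0" "c \<le> sum w' S"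
        using insert.prems True sw' by (auto simp: w'_def)
      thus ?thesis using insert.IH[of w'] insert.prems(3) that by blast
    qed
    have 0: "u a = 0" "v a = 0" using uv(1)[of a] by (auto simp: w'_def)
    have "finite {x. v x \<noteq> 0}"
    proof (rule finite_subset)
      show "{x. v x \<noteq> 0} \<subseteq> S"
      proof
        fix x assume "x \<in> {x. v x \<noteq> 0}"
        hence "w' x \<noteq> 0" using uv(1)[of x] by auto
        thus "x \<in> S" using insert.prems(2)[of x] by (auto simp: w'_def split: if_splits)
      qed
    qed fact
    moreover have "{x. (v(a := w a)) x \<noteq> 0} \<subseteq> insert a {x. v x \<noteq> 0}" by auto
    ultimately have "card {x. (v(a := w a)) x \<noteq> 0} \<le> card (insert a {x. v x \<noteq> 0})"
      by (intro card_mono) auto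
    also have "\<dots> \<le> card {x. v x \<noteq> 0} + 1"
      using \<open>finite {x. v x \<noteq> 0}\<close> by (simp add: card_insert_if)
    finally have *: "card {x. (v(a := w a)) x \<noteq> 0} \<le> card {x. v x \<noteq> 0} + 1" .
    show ?thesis
    proof (rule exI[of _ u], rule exI[of _ "v(a := w a)"], intro conjI allI)
      fix x
      show "0 \<le> u x" "0 \<le> (v(a := w a)) x" "w x = u x + (v(a := w a)) x"
        using uv(1)[of x] 0 insert.prems(1)[of x] by (auto simp: w'_def split: if_splits)
    next
      show "sum u (insert a S) = c" using uv(2) 0 insert.hyps by simp
      show "card {x. u x \<noteq> 0} + card {x. (v(a := w a)) x \<noteq> 0} \<le> card (insert a S) + 1"
        using * uv(3) insert.hyps by simp
    qed
  next
    case False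
    let ?u = "\<lambda>x. if x = a then c - sum w S else w x" and ?v = "\<lambda>x. if x = a then w a - (c - sum w S) else 0"
    have sub: "{x. ?u x \<noteq> 0} \<subseteq> insert a S" "{x. ?v x \<noteq> 0} \<subseteq> {a}" using insert.prems by auto
    have "card {x. ?u x \<noteq> 0} \<le> card (insert a S)" "card {x. ?v x \<noteq> 0} \<le> card {a}"
      using card_mono[OF _ sub(1)] card_mono[OF _ sub(2)] insert.hyps(1) by blast+
    moreover have "sum ?u S = sum w S" using insert.hyps by (intro sum.cong) auto
    ultimately have "card {x. ?u x \<noteq> 0} + card {x. ?v x \<noteq> 0} \<le> card (insert a S) + 1" "sum ?u (insert a S) = c"
      using insert.hyps by simp_all
    moreover have "?u x \<ge> 0 \<and> ?v x \<ge> 0 \<and> w x = ?u x + ?v x" for x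
      using False insert by auto
    ultimately show ?thesis
      by - (rule exI[of _ ?u], rule exI[of _ ?v], intro conjI allI; simp)
  qed
qed

text \<open>
  The bound for the Jensen defect on \<open>r + 1\<close> points. Any function that vanishes at \<open>0\<close> and
  satisfies the inequality in \<open>jensen_bound_split\<close> below would serve; this one is convenient
  because the inequality for positive \<open>s\<close>, \<open>t\<close> is just \<open>4 s t \<le> (s + t)\<^sup>2\<close>.
\<close>

definition jensen_bound :: "nat \<Rightarrow> real" where
  "jensen_bound r = (if r = 0 then 0 else 1 + 1 / 2 * log 2 r)"

lemma log_mult_le:
  assumes "s > 0" "t > 0" "s + t \<le> r"
  shows "log 2 (real s) + log 2 (real t) \<le> 2 * log 2 (real r) - 2"
proof -
  have "4 * (real s * real t) \<le> (real s + real t)\<^sup>2"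
    using zero_le_power2[of "real s - real t"] by (simp add: power2_eq_square algebra_simps)
  also have "\<dots> \<le> (real r)\<^sup>2" using assms by (intro power_mono) auto
  finally have "log 2 (real s * real t) \<le> log 2 ((real r)\<^sup>2 / 2\<^sup>2)"
    using assms by (subst log_le_cancel_iff) auto
  moreover have "log 2 ((real r)\<^sup>2 / 2\<^sup>2) = 2 * log 2 (real r) - 2"
    using assms log_pow_cancel[of "2::real" 2] by (simp add: log_divide log_nat_power del: log_pow_cancel)
  ultimately show ?thesis using assms by (simp add: log_mult)
qed

text \<open>
  This is the recursion produced by one halving step: a point set of \<open>r + 1\<close> elements is replaced
  by two sets of \<open>s + 1\<close> and \<open>t + 1\<close> elements, the midpoint inequality costs \<open>1/2\<close>, and the two
  remaining defects are averaged.
\<close>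

lemma jensen_bound_split:
  assumes "s + t \<le> r" "r > 0"
  shows "1 / 2 + (jensen_bound s + jensen_bound t) / 2 \<le> jensen_bound r"
proof -
  have l: "log 2 (real s) \<le> log 2 (real r)" if "s > 0" "s \<le> r" for s r using that by simp
  have l0: "log 2 (real r) \<ge> 0" using assms by simp
  have *: "1 / 2 + (1 + 1 / 2 * a) / 2 \<le> 1 + 1 / 2 * b" if "a \<le> b" "b \<ge> 0" for a b :: real
    using that by argo
  consider "s = 0" "t = 0" | "s = 0" "t > 0" | "s > 0" "t = 0" | "s > 0" "t > 0" by blast
  thus ?thesis
  proof cases
    case 1
    thus ?thesis using l0 assms by (simp add: jensen_bound_def)
  next
    case 2
    thus ?thesis using *[OF l[of t r] l0] assms by (simp add: jensen_bound_def del: log_le_cancel_iff)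
  next
    case 3
    thus ?thesis using *[OF l[of s r] l0] assms by (simp add: jensen_bound_def del: log_le_cancel_iff)
  next
    case 4
    thus ?thesis using log_mult_le[of s t r] assms by (simp add: jensen_bound_def field_simps)
  qed
qed

text \<open>
  Halving need not decrease the number of points: if one weight is at least \<open>1/2\<close>, the split may
  produce a single point and a set of the original size. Therefore the induction is
  on the number \<open>k\<close> of halving steps, with an error term that starts from the trivial bound
  \<open>2 B\<close>. Making the error proportional to \<open>p - 1\<close> lets it be halved at each step, because the
  numbers \<open>p - 1\<close> of the two parts add up to at most the original one.
\<close>

lemma jensen_defect_iterated:
  assumes "convex_in n K" "\<And>x. x \<in> K \<Longrightarrow> \<bar>f x\<bar> \<le> B"
    and mid: "\<And>x y. \<lbrakk>x \<in> K; y \<in> K\<rbrakk> \<Longrightarrow> f (\<lambda>i. (x i + y i) / 2) \<le> (f x + f y) / 2 + 1 / 2"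
    and "convex_weights K w" "card {x. w x \<noteq> 0} = p"
  shows "f (barycentre w) - mean w f \<le> jensen_bound (p - 1) + 2 * B * (p - 1) / 2 ^ k"
  using assms(4,5)
proof (induction k arbitrary: w p)
  case 0
  show ?case
  proof (cases "p = 1")
    case True
    then obtain a where "a \<in> K" "\<And>g. mean w g = g a" using convex_weights_singleton 0 by metis
    thus ?thesis using True by (simp add: barycentre_def jensen_bound_def)
  next
    case False
    hence p: "p \<ge> 2" using convex_weights_support_card[OF 0(1)] 0(2) by linarith
    have B: "\<bar>f (barycentre w)\<bar> \<le> B" "\<bar>mean w f\<bar> \<le> B"
      using assms(2) mean_bounded[OF 0(1)] barycentre_in[OF assms(1) 0(1)] by auto
    have "2 * B * 1 \<le> 2 * B * real (p - 1)" using p B by (intro mult_left_mono) auto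
    moreover have "jensen_bound (p - 1) \<ge> 0" using p by (simp add: jensen_bound_def)
    ultimately show ?thesis using B by simp
  qed
next
  case (Suc k)
  show ?case
  proof (cases "p = 1")
    case True
    then obtain a where "a \<in> K" "\<And>g. mean w g = g a" using convex_weights_singleton Suc.prems by metis
    thus ?thesis using True by (simp add: barycentre_def jensen_bound_def)
  next
    case False
    hence p: "p \<ge> 2" using convex_weights_support_card[OF Suc.prems(1)] Suc.prems(2) by linarith
    have fin: "finite {x. w x \<noteq> 0}" and w: "\<And>x. w x \<ge> 0" "mean w (\<lambda>_. 1) = 1" "{x. w x \<noteq> 0} \<subseteq> K"
      using Suc.prems by (auto simp: convex_weights_def)
    have "\<exists>u v. (\<forall>x. u x \<ge> 0 \<and> v x \<ge> 0 \<and> w x = u x + (v x :: real)) \<and> sum u {x. w x \<noteq> 0} = 1/2 \<and>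
            card {x. u x \<noteq> 0} + card {x. v x \<noteq> 0} \<le> card {x. w x \<noteq> 0} + 1"
      using fin w by (intro split_weights) (auto simp: mean_def)
    then obtain u v where uv: "\<And>x. u x \<ge> 0" "\<And>x. v x \<ge> 0" "\<And>x. w x = u x + v x"
        "sum u {x. w x \<noteq> 0} = 1/2" "card {x. u x \<noteq> 0} + card {x. v x \<noteq> 0} \<le> p + 1"
      unfolding Suc.prems(2) by blast
    have sub: "{x. u x \<noteq> 0} \<subseteq> {x. w x \<noteq> 0}" "{x. v x \<noteq> 0} \<subseteq> {x. w x \<noteq> 0}"
      using uv(1-3) by (auto simp: add_nonneg_eq_0_iff)
    hence fin': "finite {x. u x \<noteq> 0}" "finite {x. v x \<noteq> 0}" using fin by (auto intro: finite_subset)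
    define u' v' where "u' x = 2 * u x" and "v' x = 2 * v x" for x
    have supp: "{x. u' x \<noteq> 0} = {x. u x \<noteq> 0}" "{x. v' x \<noteq> 0} = {x. v x \<noteq> 0}"
      by (auto simp: u'_def v'_def)
    have w_eq: "w = (\<lambda>x. (1/2) * u' x + (1/2) * v' x)" using uv(3) by (auto simp: u'_def v'_def)
    have mw: "mean w g = (mean u' g + mean v' g) / 2" for g
      unfolding w_eq using fin' supp by (subst mean_linear) auto
    have "mean u (\<lambda>_. 1) = 1/2" using mean_eq_sum[OF fin sub(1)] uv(4) by simp
    hence mu1: "mean u' (\<lambda>_. 1) = 1" using fin' unfolding u'_def by (simp add: mean_scale)
    hence mv1: "mean v' (\<lambda>_. 1) = 1" using mw[of "\<lambda>_. 1"] w by simp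
    have cw: "convex_weights K u'" "convex_weights K v'"
      using uv(1,2) mu1 mv1 fin' sub w(3) unfolding convex_weights_def supp
      by (auto simp: u'_def v'_def)
    define a b where "a = card {x. u' x \<noteq> 0} - 1" and "b = card {x. v' x \<noteq> 0} - 1"
    have ab: "a + b \<le> p - 1"
      using uv(5) convex_weights_support_card[OF cw(1)] convex_weights_support_card[OF cw(2)]
      unfolding a_def b_def supp by linarith
    have bw: "barycentre w = (\<lambda>i. (barycentre u' i + barycentre v' i) / 2)"
      unfolding barycentre_def mw ..
    have "f (barycentre w) \<le> (f (barycentre u') + f (barycentre v')) / 2 + 1 / 2"
      unfolding bw using cw by (intro mid barycentre_in[OF assms(1)])
    moreover have "f (barycentre u') - mean u' f \<le> jensen_bound a + 2 * B * a / 2 ^ k"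
      using Suc.IH[OF cw(1) refl] by (simp add: a_def)
    moreover have "f (barycentre v') - mean v' f \<le> jensen_bound b + 2 * B * b / 2 ^ k"
      using Suc.IH[OF cw(2) refl] by (simp add: b_def)
    ultimately have "f (barycentre w) - mean w f \<le>
        (1 / 2 + (jensen_bound a + jensen_bound b) / 2) + (2 * B * a / 2 ^ k + 2 * B * b / 2 ^ k) / 2"
      unfolding mw by argo
    also have "1 / 2 + (jensen_bound a + jensen_bound b) / 2 \<le> jensen_bound (p - 1)"
      using ab p by (intro jensen_bound_split) auto
    also have "(2 * B * a / 2 ^ k + 2 * B * b / 2 ^ k) / 2 = 2 * B * real (a + b) / 2 ^ Suc k"
      by (simp add: field_simps)
    also have "\<dots> \<le> 2 * B * real (p - 1) / 2 ^ Suc k"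
    proof -
      have "B \<ge> 0" using assms(2) barycentre_in[OF assms(1) cw(1)] abs_ge_zero order_trans by blast
      thus ?thesis using ab by (intro divide_right_mono mult_left_mono) auto
    qed
    finally show ?thesis by simp
  qed
qed

lemma jensen_defect:
  assumes "convex_in n K" "\<And>x. x \<in> K \<Longrightarrow> \<bar>f x\<bar> \<le> B"
    and "\<And>x y. \<lbrakk>x \<in> K; y \<in> K\<rbrakk> \<Longrightarrow> f (\<lambda>i. (x i + y i) / 2) \<le> (f x + f y) / 2 + 1 / 2"
    and "convex_weights K w"
  shows "f (barycentre w) - mean w f \<le> jensen_bound (card {x. w x \<noteq> 0} - 1)"
proof (rule LIMSEQ_le_const)
  let ?p = "card {x. w x \<noteq> 0}"
  have "(\<lambda>k. jensen_bound (?p - 1) + 2 * B * (?p - 1) * (1/2) ^ k) \<longlonglongrightarrow> jensen_bound (?p - 1) + 2 * B * (?p - 1) * 0"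
    by (intro tendsto_intros LIMSEQ_power_zero) auto
  thus "(\<lambda>k. jensen_bound (?p - 1) + 2 * B * (?p - 1) / 2 ^ k) \<longlonglongrightarrow> jensen_bound (?p - 1)"
    by (simp add: power_divide)
  show "\<exists>N. \<forall>k\<ge>N. f (barycentre w) - mean w f \<le> jensen_bound (?p - 1) + 2 * B * (?p - 1) / 2 ^ k"
    using jensen_defect_iterated[where f = f, OF assms refl] by blast
qed

section \<open>Reduction to few points\<close>

text \<open>
  Fewer equations than unknowns: Gaussian elimination of one unknown per equation.
\<close>

lemma homogeneous_system_nontrivial:
  fixes A :: "nat \<Rightarrow> 'a \<Rightarrow> real"
  assumes "finite S" "card S > m"
  shows "\<exists>c. (\<exists>s\<in>S. c s \<noteq> 0) \<and> (\<forall>k<m. (\<Sum>s\<in>S. A k s * c s) = 0)"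
  using assms
proof (induction m arbitrary: S A)
  case 0
  hence "S \<noteq> {}" by auto
  thus ?case by (intro exI[of _ "\<lambda>_. 1"]) auto
next
  case (Suc m)
  show ?case
  proof (cases "\<forall>s\<in>S. A m s = 0")
    case True
    have "card S > m" using Suc.prems by simp
    then obtain c where "\<exists>s\<in>S. c s \<noteq> 0" "\<forall>k<m. (\<Sum>s\<in>S. A k s * c s) = 0"
      using Suc.IH[OF Suc.prems(1)] by blast
    thus ?thesis using True by (intro exI[of _ c]) (auto simp: less_Suc_eq)
  next
    case False
    then obtain a where a: "a \<in> S" "A m a \<noteq> 0" by blast
    define A' where "A' k s = A k s - A k a * A m s / A m a" for k s
    have "card (S - {a}) > m" using Suc.prems a by simp
    then obtain c where c: "\<exists>s\<in>S - {a}. c s \<noteq> 0" "\<And>k. k < m \<Longrightarrow> (\<Sum>s\<in>S - {a}. A' k s * c s) = 0"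
      using Suc.IH[of "S - {a}" A'] Suc.prems by auto
    define T where "T = (\<Sum>s\<in>S - {a}. A m s * c s)"
    define c' where "c' = c(a := - T / A m a)"
    have *: "(\<Sum>s\<in>S. A k s * c' s) = A k a * (- T / A m a) + (\<Sum>s\<in>S - {a}. A k s * c s)" for k
    proof -
      have "(\<Sum>s\<in>S. A k s * c' s) = A k a * c' a + (\<Sum>s\<in>S - {a}. A k s * c' s)"
        using Suc.prems a by (intro sum.remove) auto
      also have "(\<Sum>s\<in>S - {a}. A k s * c' s) = (\<Sum>s\<in>S - {a}. A k s * c s)"
        by (intro sum.cong) (auto simp: c'_def)
      finally show ?thesis by (simp add: c'_def)
    qed
    have "(\<Sum>s\<in>S. A k s * c' s) = 0" if "k < Suc m" for k
    proof (cases "k = m")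
      case True
      thus ?thesis using a unfolding * by (simp add: T_def)
    next
      case False
      hence "0 = (\<Sum>s\<in>S - {a}. A' k s * c s)" using c(2) that by auto
      also have "\<dots> = (\<Sum>s\<in>S - {a}. A k s * c s - A k a / A m a * (A m s * c s))"
        by (intro sum.cong) (auto simp: A'_def algebra_simps)
      also have "\<dots> = (\<Sum>s\<in>S - {a}. A k s * c s) - A k a / A m a * T"
        by (simp only: sum_subtractf sum_distrib_left[symmetric] T_def)
      finally show ?thesis unfolding * by (simp add: algebra_simps)
    qed
    moreover have "\<exists>s\<in>S. c' s \<noteq> 0" using c(1) by (auto simp: c'_def)
    ultimately show ?thesis by blast
  qed
qed

lemma step_to_boundary:
  fixes W c :: "'a \<Rightarrow> real"
  assumes "finite I" "\<And>s. s \<in> I \<Longrightarrow> W s > 0" "\<exists>s\<in>I. c s < 0"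
  obtains t where "t \<ge> 0" "\<And>s. s \<in> I \<Longrightarrow> W s + t * c s \<ge> 0" "\<exists>s\<in>I. W s + t * c s = 0"
proof -
  let ?T = "(\<lambda>s. W s / - c s) ` {s \<in> I. c s < 0}"
  have T: "finite ?T" "?T \<noteq> {}" using assms by auto
  define t where "t = Min ?T"
  have "t \<in> ?T" unfolding t_def using T by (rule Min_in)
  then obtain s where s: "s \<in> I" "c s < 0" "t = W s / - c s" by auto
  have "t \<ge> 0" unfolding s(3) using s(2) assms(2)[OF s(1)] by (intro divide_nonneg_pos) auto
  moreover have "W s + t * c s = 0" using s by simp
  moreover have "W r + t * c r \<ge> 0" if "r \<in> I" for r
  proof (cases "c r < 0")
    case True
    hence "t \<le> W r / - c r" unfolding t_def using T that by (intro Min_le) auto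
    thus ?thesis using True by (simp add: field_simps)
  next
    case False
    thus ?thesis using \<open>t \<ge> 0\<close> assms(2)[OF that] by simp
  qed
  ultimately show ?thesis using s(1) that by blast
qed

text \<open>
  The signs are those of the difference of two barycentres. The unknowns \<open>c (Inl x)\<close> perturb
  the weights of the first one, \<open>c (Inr x)\<close> those of the second one. Keeping both total
  weights and the \<open>n\<close> coordinates of the difference amounts to \<open>n + 2\<close> linear equations, so more
  than \<open>n + 2\<close> points leave a nontrivial direction. Its entries sum to \<open>0\<close>, so it and its negative
  both have negative entries, and the sign can be chosen so that the functional given by \<open>f\<close>
  does not decrease.
\<close>

lemma affine_dependence_pair:
  fixes P Q :: "(nat \<Rightarrow> real) set" and f :: "(nat \<Rightarrow> real) \<Rightarrow> real"
  assumes fin: "finite P" "finite Q" and card: "card P + card Q > n + 2"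
  obtains c where "\<exists>s\<in>P <+> Q. c s < 0"
    "(\<Sum>x\<in>P. c (Inl x)) = 0" "(\<Sum>x\<in>Q. c (Inr x)) = 0"
    "\<And>i. i < n \<Longrightarrow> (\<Sum>x\<in>P. c (Inl x) * x i) = (\<Sum>x\<in>Q. c (Inr x) * x i)"
    "(\<Sum>x\<in>P. c (Inl x) * f x) - (\<Sum>x\<in>Q. c (Inr x) * f x) \<ge> 0"
proof -
  define A :: "nat \<Rightarrow> (nat \<Rightarrow> real) + (nat \<Rightarrow> real) \<Rightarrow> real" where
    "A k s = (case s of Inl x \<Rightarrow> if k < n then x k else if k = n then 1 else 0
                      | Inr x \<Rightarrow> if k < n then - x k else if k = n then 0 else 1)" for k s
  have "card (P <+> Q) > n + 2" using fin card by (simp add: card_Plus)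
  then obtain c where c: "\<exists>s\<in>P <+> Q. c s \<noteq> 0" "\<And>k. k < n + 2 \<Longrightarrow> (\<Sum>s\<in>P <+> Q. A k s * c s) = 0"
    using homogeneous_system_nontrivial[of "P <+> Q" "n + 2" A] fin by auto
  have eq: "(\<Sum>x\<in>P. A k (Inl x) * c (Inl x)) + (\<Sum>x\<in>Q. A k (Inr x) * c (Inr x)) = 0" if "k < n + 2" for k
    using c(2)[OF that] fin by (simp add: sum.Plus)
  have 1: "(\<Sum>x\<in>P. c (Inl x)) = 0" using eq[of n] by (simp add: A_def)
  have 2: "(\<Sum>x\<in>Q. c (Inr x)) = 0" using eq[of "n + 1"] by (simp add: A_def)
  have 3: "(\<Sum>x\<in>P. c (Inl x) * x i) = (\<Sum>x\<in>Q. c (Inr x) * x i)" if "i < n" for i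
    using eq[of i] that by (simp add: A_def sum_negf mult.commute)
  have neg: "\<exists>s\<in>P <+> Q. \<sigma> * c s < 0" if "\<sigma> \<noteq> 0" for \<sigma> :: real
  proof (rule ccontr)
    assume "\<not> ?thesis"
    hence "\<And>s. s \<in> P <+> Q \<Longrightarrow> \<sigma> * c s \<ge> 0" using not_less by blast
    moreover have "(\<Sum>s\<in>P <+> Q. \<sigma> * c s) = 0"
      using fin 1 2 by (simp add: sum.Plus flip: sum_distrib_left)
    ultimately have "\<forall>s\<in>P <+> Q. \<sigma> * c s = 0" using fin by (subst (asm) sum_nonneg_eq_0_iff) auto
    thus False using c(1) that by auto
  qed
  define \<sigma> :: real where
    "\<sigma> = (if (\<Sum>x\<in>P. c (Inl x) * f x) - (\<Sum>x\<in>Q. c (Inr x) * f x) \<ge> 0 then 1 else - 1)"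
  have "\<sigma> * ((\<Sum>x\<in>P. c (Inl x) * f x) - (\<Sum>x\<in>Q. c (Inr x) * f x)) \<ge> 0"
    by (simp add: \<sigma>_def)
  hence "(\<Sum>x\<in>P. \<sigma> * c (Inl x) * f x) - (\<Sum>x\<in>Q. \<sigma> * c (Inr x) * f x) \<ge> 0"
    by (simp add: right_diff_distrib sum_distrib_left mult.assoc)
  moreover have "\<sigma> \<noteq> 0" by (simp add: \<sigma>_def)
  ultimately show ?thesis
    using neg 1 2 3 by (intro that[of "\<lambda>s. \<sigma> * c s"])
      (simp_all add: mult.assoc flip: sum_distrib_left)
qed

text \<open>
  A quantitative form of Radon's theorem. The two barycentres may differ;
  their difference is preserved, which is what the separation argument needs in order to keep a
  positive distance from the origin. As long as more than \<open>n + 2\<close> points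
  are involved, an affine dependence allows one of the weights to be moved to zero.
\<close>

lemma reduce_support:
  fixes f :: "(nat \<Rightarrow> real) \<Rightarrow> real"
  assumes "convex_weights K w" "convex_weights K v"
  shows "\<exists>w' v'. convex_weights K w' \<and> convex_weights K v' \<and>
     card {x. w' x \<noteq> 0} + card {x. v' x \<noteq> 0} \<le> n + 2 \<and>
     (\<forall>i<n. barycentre w' i - barycentre v' i = barycentre w i - barycentre v i) \<and>
     mean w f - mean v f \<le> mean w' f - mean v' f"
  using assms
proof (induction "card {x. w x \<noteq> 0} + card {x. v x \<noteq> 0}" arbitrary: w v rule: less_induct)
  case less
  define P Q where "P = {x. w x \<noteq> 0}" and "Q = {x. v x \<noteq> 0}"
  have fin: "finite P" "finite Q" and sub: "P \<subseteq> K" "Q \<subseteq> K"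
    and w: "\<And>x. w x \<ge> 0" "\<And>x. v x \<ge> 0" "mean w (\<lambda>_. 1) = 1" "mean v (\<lambda>_. 1) = 1"
    using less.prems by (auto simp: P_def Q_def convex_weights_def)
  show ?case
  proof (cases "card P + card Q \<le> n + 2")
    case True
    thus ?thesis using less.prems unfolding P_def Q_def by blast
  next
    case False
    hence "card P + card Q > n + 2" by simp
    from affine_dependence_pair[OF fin this, where f = f] obtain c where
      c: "\<exists>s\<in>P <+> Q. c s < 0" "(\<Sum>x\<in>P. c (Inl x)) = 0" "(\<Sum>x\<in>Q. c (Inr x)) = 0"
         "\<And>i. i < n \<Longrightarrow> (\<Sum>x\<in>P. c (Inl x) * x i) = (\<Sum>x\<in>Q. c (Inr x) * x i)"
         "(\<Sum>x\<in>P. c (Inl x) * f x) - (\<Sum>x\<in>Q. c (Inr x) * f x) \<ge> 0" by blast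
    define \<alpha> \<beta> where "\<alpha> x = (if x \<in> P then c (Inl x) else 0)" and "\<beta> x = (if x \<in> Q then c (Inr x) else 0)" for x
    have supp: "{x. \<alpha> x \<noteq> 0} \<subseteq> P" "{x. \<beta> x \<noteq> 0} \<subseteq> Q" by (auto simp: \<alpha>_def \<beta>_def)
    have m\<alpha>: "mean \<alpha> g = (\<Sum>x\<in>P. c (Inl x) * g x)" for g
      unfolding mean_eq_sum[OF fin(1) supp(1)] by (intro sum.cong) (auto simp: \<alpha>_def)
    have m\<beta>: "mean \<beta> g = (\<Sum>x\<in>Q. c (Inr x) * g x)" for g
      unfolding mean_eq_sum[OF fin(2) supp(2)] by (intro sum.cong) (auto simp: \<beta>_def)
    obtain t where t: "t \<ge> 0" "\<And>s. s \<in> P <+> Q \<Longrightarrow> case_sum w v s + t * c s \<ge> 0"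
        "\<exists>s\<in>P <+> Q. case_sum w v s + t * c s = 0"
    proof (rule step_to_boundary)
      show "finite (P <+> Q)" using fin by simp
      show "case_sum w v s > 0" if "s \<in> P <+> Q" for s
        using that w(1,2) by (auto simp: P_def Q_def less_le)
    qed (use c(1) in auto)
    define w' v' where "w' x = 1 * w x + t * \<alpha> x" and "v' x = 1 * v x + t * \<beta> x" for x
    have fs: "finite {x. \<alpha> x \<noteq> 0}" "finite {x. \<beta> x \<noteq> 0}" using supp fin by (auto intro: finite_subset)
    have mw': "mean w' g = mean w g + t * mean \<alpha> g" and mv': "mean v' g = mean v g + t * mean \<beta> g" for g
      unfolding w'_def v'_def
      using fin fs mean_linear[of w \<alpha> 1 t g] mean_linear[of v \<beta> 1 t g] by (simp_all add: P_def Q_def)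
    have supp': "{x. w' x \<noteq> 0} \<subseteq> P" "{x. v' x \<noteq> 0} \<subseteq> Q"
      by (auto simp: w'_def v'_def \<alpha>_def \<beta>_def P_def Q_def)
    have "w' x \<ge> 0" "v' x \<ge> 0" for x
      using t(2)[of "Inl x"] t(2)[of "Inr x"] w by (auto simp: w'_def v'_def \<alpha>_def \<beta>_def)
    moreover have "mean w' (\<lambda>_. 1) = 1" "mean v' (\<lambda>_. 1) = 1"
      using c w by (simp_all add: mw' mv' m\<alpha> m\<beta>)
    ultimately have cw: "convex_weights K w'" "convex_weights K v'"
      using supp' fin sub unfolding convex_weights_def by (auto intro: finite_subset)
    have "card {x. w' x \<noteq> 0} + card {x. v' x \<noteq> 0} < card P + card Q"
    proof -
      obtain s where s: "s \<in> P <+> Q" "case_sum w v s + t * c s = 0" using t(3) by blast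
      have le: "card {x. w' x \<noteq> 0} \<le> card P" "card {x. v' x \<noteq> 0} \<le> card Q"
        using supp' fin by (auto intro: card_mono)
      from s(1) show ?thesis
      proof (rule PlusE)
        fix x assume x: "x \<in> P" "s = Inl x"
        hence "w' x = 0" using s(2) by (simp add: w'_def \<alpha>_def)
        hence "{x. w' x \<noteq> 0} \<subset> P" using supp' x(1) by blast
        hence "card {x. w' x \<noteq> 0} < card P" by (rule psubset_card_mono[OF fin(1)])
        thus ?thesis using le by simp
      next
        fix x assume x: "x \<in> Q" "s = Inr x"
        hence "v' x = 0" using s(2) by (simp add: v'_def \<beta>_def)
        hence "{x. v' x \<noteq> 0} \<subset> Q" using supp' x(1) by blast
        hence "card {x. v' x \<noteq> 0} < card Q" by (rule psubset_card_mono[OF fin(2)])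
        thus ?thesis using le by simp
      qed
    qed
    from less.hyps[OF this[unfolded P_def Q_def] cw] obtain w2 v2 where
      wv2: "convex_weights K w2" "convex_weights K v2"
        "card {x. w2 x \<noteq> 0} + card {x. v2 x \<noteq> 0} \<le> n + 2"
        "\<forall>i<n. barycentre w2 i - barycentre v2 i = barycentre w' i - barycentre v' i"
        "mean w' f - mean v' f \<le> mean w2 f - mean v2 f" by blast
    moreover have "barycentre w' i - barycentre v' i = barycentre w i - barycentre v i" if "i < n" for i
      using c(4)[OF that] by (simp add: barycentre_def mw' mv' m\<alpha> m\<beta>)
    moreover have "mean w f - mean v f \<le> mean w' f - mean v' f"
      using mult_nonneg_nonneg[OF t(1) c(5)] by (simp add: mw' mv' m\<alpha> m\<beta> algebra_simps)
    ultimately show ?thesis by - (rule exI[of _ w2], rule exI[of _ v2], auto)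
  qed
qed

text \<open>
  The two Jensen defects, one bounding \<open>f\<close> from above at the barycentre of \<open>v\<close> and one bounding it
  from below at the barycentre of \<open>w\<close>, are added. Since the two supports have at most \<open>n + 2\<close>
  points, the parameters \<open>a\<close>, \<open>b\<close> satisfy \<open>a + b \<le> n\<close>, and the recursive inequality for the
  bound, read from right to left, controls the sum of the defects.
\<close>

lemma mean_difference_bound:
  assumes K: "convex_in n K" "\<And>x. x \<in> K \<Longrightarrow> \<bar>f x\<bar> \<le> B" and n: "n \<ge> 1"
    and mid: "\<And>x y. \<lbrakk>x \<in> K; y \<in> K\<rbrakk> \<Longrightarrow> \<bar>f x + f y - 2 * f (\<lambda>i. (x i + y i) / 2)\<bar> \<le> 1"
    and w: "convex_weights K w" "convex_weights K v"
    and card: "card {x. w x \<noteq> 0} + card {x. v x \<noteq> 0} \<le> n + 2"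
  shows "mean w f - mean v f \<le> 1 + log 2 n + (f (barycentre w) - f (barycentre v))"
proof -
  define a b where "a = card {x. w x \<noteq> 0} - 1" and "b = card {x. v x \<noteq> 0} - 1"
  have "f (barycentre v) - mean v f \<le> jensen_bound b"
    unfolding b_def
  proof (rule jensen_defect[OF K _ w(2)])
    fix x y assume "x \<in> K" "y \<in> K"
    from mid[OF this] show "f (\<lambda>i. (x i + y i) / 2) \<le> (f x + f y) / 2 + 1 / 2" by argo
  qed
  moreover have "- f (barycentre w) - mean w (\<lambda>x. - f x) \<le> jensen_bound a"
    unfolding a_def
  proof (rule jensen_defect[OF K(1) _ _ w(1), where B = B])
    fix x y assume "x \<in> K" "y \<in> K"
    from mid[OF this] show "- f (\<lambda>i. (x i + y i) / 2) \<le> (- f x + - f y) / 2 + 1 / 2" by argo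
  qed (use K(2) in simp)
  moreover have "mean w (\<lambda>x. - f x) = - mean w f"
    using mean_linear_right[of w "-1" f 0 f] by simp
  moreover have "1 / 2 + (jensen_bound a + jensen_bound b) / 2 \<le> jensen_bound n"
    using card convex_weights_support_card[OF w(1)] convex_weights_support_card[OF w(2)] n
    by (intro jensen_bound_split) (auto simp: a_def b_def)
  moreover have "jensen_bound n = 1 + log 2 n / 2" using n by (simp add: jensen_bound_def)
  ultimately show ?thesis by argo
qed

section \<open>Separation and the upper bound\<close>

text \<open>
  A point of almost minimal norm defines the separating functional: if \<open>z \<bullet> x\<close> were not
  positive, a small step from \<open>z\<close> towards \<open>x\<close> would decrease the norm by a definite amount. As \<open>D\<close>
  is bounded, the size of the step and of the decrease are uniform in \<open>x\<close>, and choosing \<open>z\<close> within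
  that amount of the infimum gives a contradiction for all \<open>x\<close> at once.
\<close>

lemma separate_from_origin:
  fixes D :: "(nat \<Rightarrow> real) set"
  assumes D: "D \<noteq> {}"
    and conv: "\<And>x y t. \<lbrakk>x \<in> D; y \<in> D; 0 \<le> t; t \<le> 1\<rbrakk> \<Longrightarrow> (\<lambda>i. (1 - t) * x i + t * y i) \<in> D"
    and upper: "\<And>x. x \<in> D \<Longrightarrow> (\<Sum>i<N. (x i)\<^sup>2) \<le> R"
    and lower: "\<And>x. x \<in> D \<Longrightarrow> \<delta> \<le> (\<Sum>i<N. (x i)\<^sup>2)" and "\<delta> > 0"
  obtains a where "\<And>x. x \<in> D \<Longrightarrow> (\<Sum>i<N. a i * x i) > 0"
proof -
  define q where "q x = (\<Sum>i<N. (x i)\<^sup>2)" for x :: "nat \<Rightarrow> real"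
  define m where "m = (INF x\<in>D. q x)"
  have bdd: "bdd_below (q ` D)" unfolding q_def by (rule bdd_belowI2[of _ \<delta>]) (rule lower)
  have m: "m \<le> q x" if "x \<in> D" for x unfolding m_def using bdd that by (rule cINF_lower)
  obtain x0 where "x0 \<in> D" using D by blast
  hence R: "R \<ge> \<delta>" using upper lower by (meson order_trans)
  \<comment> \<open>The step length balances the linear gain against the quadratic term, which is at most
    \<open>4 * R * t\<^sup>2\<close>; the admissible excess \<open>\<delta> * t\<close> of \<open>q z\<close> over the infimum is of the same size.\<close>
  define t where "t = \<delta> / (4 * R)"
  have t: "t > 0" "t \<le> 1" using R \<open>\<delta> > 0\<close> by (auto simp: t_def field_simps)
  have "m < m + \<delta> * t" using t \<open>\<delta> > 0\<close> by simp
  then obtain z where z: "z \<in> D" "q z < m + \<delta> * t"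
    unfolding m_def using cINF_less_iff[OF D bdd] by metis
  show ?thesis
  proof (rule that[of z])
    fix x assume x: "x \<in> D"
    define s where "s = (\<Sum>i<N. z i * x i)"
    have "m \<le> q (\<lambda>i. (1 - t) * z i + t * x i)" using conv[OF z(1) x] t m by simp
    also have "\<dots> = (\<Sum>i<N. ((z i)\<^sup>2 + 2 * t * (z i * x i)) - 2 * t * (z i)\<^sup>2 + t\<^sup>2 * (x i - z i)\<^sup>2)"
      unfolding q_def by (intro sum.cong) (auto simp: power2_eq_square algebra_simps)
    also have "\<dots> = q z + 2 * t * s - 2 * t * q z + t\<^sup>2 * (\<Sum>i<N. (x i - z i)\<^sup>2)"
      by (simp add: q_def s_def sum.distrib sum_subtractf sum_distrib_left)
    also have "(\<Sum>i<N. (x i - z i)\<^sup>2) \<le> (\<Sum>i<N. 2 * (x i)\<^sup>2 + 2 * (z i)\<^sup>2)"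
    proof (rule sum_mono)
      fix i
      show "(x i - z i)\<^sup>2 \<le> 2 * (x i)\<^sup>2 + 2 * (z i)\<^sup>2"
        using zero_le_power2[of "x i + z i"] by (simp add: power2_eq_square algebra_simps)
    qed
    also have "(\<Sum>i<N. 2 * (x i)\<^sup>2 + 2 * (z i)\<^sup>2) \<le> 4 * R"
      using upper[OF x] upper[OF z(1)] by (simp add: sum.distrib flip: sum_distrib_left)
    finally have "m \<le> q z + 2 * t * s - 2 * t * q z + t\<^sup>2 * (4 * R)"
      by (simp add: mult_left_mono)
    also have "t\<^sup>2 * (4 * R) = \<delta> * t" using R \<open>\<delta> > 0\<close> by (simp add: t_def power2_eq_square)
    finally have "0 < t * (2 * s - 2 * q z + 2 * \<delta>)" using z(2) by (simp add: algebra_simps)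
    hence "0 < 2 * s - 2 * q z + 2 * \<delta>" using t by (simp add: zero_less_mult_iff)
    moreover have "q z \<ge> \<delta>" using lower[OF z(1)] by (simp add: q_def)
    ultimately show "(\<Sum>i<N. z i * x i) > 0" by (simp add: s_def)
  qed
qed

text \<open>
  An affine \<open>\<phi>\<close> with \<open>\<bar>f - \<phi>\<bar> \<le> M\<close> is a nonvertical hyperplane between the graphs of \<open>f - M\<close> and
  \<open>f + M\<close>. The set \<open>D\<close> consists of the differences of a convex combination of points of the upper
  graph and one of points of the lower graph, in \<open>n + 1\<close> coordinates. It stays away from the
  origin: if the first \<open>n\<close> coordinates of an element are small, then the two barycentres are close, uniform
  continuity of \<open>f\<close> applies, and the reduction to \<open>n + 2\<close> points together with the Jensen bound
  keeps the last coordinate above a positive constant. The separating hyperplane is not vertical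
  because the two graphs lie above the same points.
\<close>

lemma best_approx_upper:
  assumes K: "K \<noteq> {}" "closedin (Euclidean_space n) K" "bounded_in n K" "convex_in n K" and n: "n \<ge> 1"
    and f: "continuous_map (subtopology (Euclidean_space n) K) euclideanreal f" "modulus n 2 f K \<le> 1"
    and M: "1 / 2 + 1 / 2 * log 2 n < M"
  shows "best_approx n 2 f K \<le> ereal M"
proof -
  have top: "K \<subseteq> topspace (Euclidean_space n)" using K by (simp add: convex_in_def)
  have comp: "compact K" using compact_Euclidean_space K by blast
  have cont: "continuous_on K f" using f(1) continuous_map_Euclidean_space_iff[OF top] by simp
  have mid: "\<bar>f x + f y - 2 * f (\<lambda>i. (x i + y i) / 2)\<bar> \<le> 1" if "x \<in> K" "y \<in> K" for x y
    using f(2) modulus_2_le_iff[OF K(4), of f 1] that by (simp add: one_ereal_def)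
  obtain B where B: "\<And>x. x \<in> K \<Longrightarrow> \<bar>f x\<bar> \<le> B"
    using compact_imp_bounded[OF compact_continuous_image[OF cont comp]] unfolding bounded_iff by force
  obtain C where C: "\<And>x i. x \<in> K \<Longrightarrow> \<bar>x i\<bar> \<le> C" using bounded_in_coordinates[OF K(3)] by blast
  have "log 2 n \<ge> 0" using n by simp
  hence "M > 0" using M by simp
  \<comment> \<open>Half of the gap between \<open>2 * M\<close> and the bound \<open>1 + log 2 n\<close> for common barycentres; the
    other half remains for the last coordinate of the points of \<open>D\<close> below.\<close>
  define \<epsilon> where "\<epsilon> = (2 * M - (1 + log 2 n)) / 2"
  have \<epsilon>: "\<epsilon> > 0" using M by (simp add: \<epsilon>_def)
  obtain d where d: "d > 0"
      "\<And>x y. \<lbrakk>x \<in> K; y \<in> K; \<And>i. i < n \<Longrightarrow> \<bar>x i - y i\<bar> < d\<rbrakk> \<Longrightarrow> \<bar>f x - f y\<bar> < \<epsilon>"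
    using uniform_continuity_coordinatewise[OF comp cont top \<epsilon>] by blast
  define z where "z w v i = (if i < n then barycentre v i - barycentre w i else mean v f - mean w f + 2 * M)"
    for w v i
  define D where "D = {z w v |w v. convex_weights K w \<and> convex_weights K v}"
  define point where "point x = (\<lambda>y. if y = x then 1 else 0 :: real)" for x :: "nat \<Rightarrow> real"
  have mean_point: "mean (point x) g = g x" for x g
    using mean_eq_sum[of "{x}" "point x" g] by (simp add: point_def)
  have point: "convex_weights K (point x)" if "x \<in> K" for x
    using mean_point[of x "\<lambda>_. 1"] that by (auto simp: convex_weights_def point_def)
  obtain a where a: "\<And>x. x \<in> D \<Longrightarrow> (\<Sum>i<Suc n. a i * x i) > 0"
  proof (rule separate_from_origin[of D "Suc n" _ "(min d \<epsilon>)\<^sup>2"])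
    show "D \<noteq> {}" using K(1) point unfolding D_def by blast
    show "(\<lambda>i. (1 - t) * x i + t * y i) \<in> D" if xy: "x \<in> D" "y \<in> D" "0 \<le> t" "t \<le> 1" for x y t
    proof -
      obtain w v w' v' where wv: "x = z w v" "y = z w' v'" "convex_weights K w" "convex_weights K v"
         "convex_weights K w'" "convex_weights K v'" using xy(1,2) unfolding D_def by blast
      have "(\<lambda>i. (1 - t) * x i + t * y i) = z (\<lambda>x. (1 - t) * w x + t * w' x) (\<lambda>x. (1 - t) * v x + t * v' x)"
      proof -
        have "mean (\<lambda>x. (1 - t) * w x + t * w' x) g = (1 - t) * mean w g + t * mean w' g"
             "mean (\<lambda>x. (1 - t) * v x + t * v' x) g = (1 - t) * mean v g + t * mean v' g" for g
          using wv(3-) by (auto intro: mean_linear simp: convex_weights_def)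
        thus ?thesis unfolding wv(1,2) by (intro ext) (simp add: z_def barycentre_def algebra_simps)
      qed
      thus ?thesis using wv xy(3,4) unfolding D_def by (blast intro: convex_weights_mix[where s = "1 - t" and t = t] diff_ge_0_iff_ge[THEN iffD2] diff_add_cancel)
    qed
    show "(\<Sum>i<Suc n. (x i)\<^sup>2) \<le> (\<Sum>i<Suc n. (2 * C + 2 * B + 2 * M)\<^sup>2)" if xD: "x \<in> D" for x
    proof (rule sum_mono)
      fix i
      obtain w v where wv: "x = z w v" "convex_weights K w" "convex_weights K v"
        using xD unfolding D_def by blast
      have "\<bar>mean w f\<bar> \<le> B" "\<bar>mean v f\<bar> \<le> B" "\<bar>barycentre w i\<bar> \<le> C" "\<bar>barycentre v i\<bar> \<le> C"
        unfolding barycentre_def using wv B C by (auto intro: mean_bounded)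
      hence "\<bar>x i\<bar> \<le> 2 * C + 2 * B + 2 * M" unfolding wv(1) z_def using \<open>M > 0\<close> by (auto simp: abs_le_iff)
      thus "(x i)\<^sup>2 \<le> (2 * C + 2 * B + 2 * M)\<^sup>2" by (metis abs_ge_zero power2_abs power_mono)
    qed
    show "(min d \<epsilon>)\<^sup>2 \<le> (\<Sum>i<Suc n. (x i)\<^sup>2)" if xD: "x \<in> D" for x
    proof -
      obtain w v where wv: "x = z w v" "convex_weights K w" "convex_weights K v"
        using xD unfolding D_def by blast
      have "\<exists>i<Suc n. min d \<epsilon> \<le> \<bar>x i\<bar>"
      proof (cases "\<exists>i<n. d \<le> \<bar>barycentre v i - barycentre w i\<bar>")
        case True
        then obtain i where "i < n" "d \<le> \<bar>x i\<bar>" unfolding wv(1) z_def by auto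
        thus ?thesis by (intro exI[of _ i]) auto
      next
        case False
        obtain w' v' where wv': "convex_weights K w'" "convex_weights K v'"
          "card {x. w' x \<noteq> 0} + card {x. v' x \<noteq> 0} \<le> n + 2"
          "\<forall>i<n. barycentre w' i - barycentre v' i = barycentre w i - barycentre v i"
          "mean w f - mean v f \<le> mean w' f - mean v' f"
          using reduce_support[OF wv(2,3)] by blast
        have "\<bar>f (barycentre w') - f (barycentre v')\<bar> < \<epsilon>"
          using wv' False by (intro d barycentre_in[OF K(4)]) (auto simp: abs_minus_commute not_le)
        moreover have "mean w' f - mean v' f \<le> 1 + log 2 n + (f (barycentre w') - f (barycentre v'))"
          by (rule mean_difference_bound[OF K(4) B n mid wv'(1-3)])
        ultimately have "mean v f - mean w f + 2 * M \<ge> \<epsilon>" using wv'(5) unfolding \<epsilon>_def by argo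
        hence "min d \<epsilon> \<le> \<bar>x n\<bar>" unfolding wv(1) z_def by simp
        thus ?thesis by blast
      qed
      then obtain i where i: "i < Suc n" "min d \<epsilon> \<le> \<bar>x i\<bar>" by blast
      hence "(min d \<epsilon>)\<^sup>2 \<le> (x i)\<^sup>2" using d(1) \<epsilon> by (intro abs_le_square_iff[THEN iffD1]) auto
      also have "\<dots> \<le> (\<Sum>i<Suc n. (x i)\<^sup>2)" using i by (intro member_le_sum) auto
      finally show ?thesis .
    qed
    show "(min d \<epsilon>)\<^sup>2 > 0" using d(1) \<epsilon> by simp
  qed blast
  define b where "b = a n"
  define l where "l x = (\<Sum>i<n. a i * x i)" for x :: "nat \<Rightarrow> real"
  have sep: "l x + b * f x < l y + b * f y + 2 * b * M" if "x \<in> K" "y \<in> K" for x y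
  proof -
    have "z (point x) (point y) \<in> D" using point that unfolding D_def by blast
    from a[OF this] have "(\<Sum>i<n. a i * (y i - x i)) + b * (f y - f x + 2 * M) > 0"
      by (simp add: z_def barycentre_def mean_point b_def)
    thus ?thesis by (simp add: l_def right_diff_distrib sum_subtractf algebra_simps)
  qed
  obtain x0 where x0: "x0 \<in> K" using K by blast
  have b: "b > 0" using sep[OF x0 x0] \<open>M > 0\<close> by (simp add: zero_less_mult_iff)
  define g where "g x = l x + b * f x" for x
  \<comment> \<open>By the separation, \<open>g\<close> oscillates by at most \<open>2 * b * M\<close> on \<open>K\<close>; \<open>c\<close> is chosen so that it is
    within \<open>b * M\<close> of \<open>g\<close> throughout.\<close>
  define c where "c = (SUP x\<in>K. g x) - b * M"
  have bdd: "bdd_above (g ` K)"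
    using sep[OF _ x0] unfolding g_def by (auto intro!: bdd_aboveI less_imp_le)
  have c1: "g x - c \<le> b * M" if "x \<in> K" for x using cSUP_upper[OF that bdd] by (simp add: c_def)
  have c2: "- (b * M) \<le> g x - c" if "x \<in> K" for x
  proof -
    have "(SUP y\<in>K. g y) \<le> g x + 2 * b * M"
      using sep[OF _ that] K(1) unfolding g_def by (intro cSUP_least less_imp_le)
    thus ?thesis unfolding c_def mult.assoc by linarith
  qed
  define \<phi> where "\<phi> x = c / b + (\<Sum>i<n. (- a i / b) * x i)" for x :: "nat \<Rightarrow> real"
  have "\<exists>c a. \<forall>x. \<phi> x = c + (\<Sum>i<n. a i * x i)"
    unfolding \<phi>_def by (rule exI[of _ "c / b"], rule exI[of _ "\<lambda>i. - a i / b"]) simp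
  hence "\<phi> \<in> polynomials n 1" by (rule polynomials_1_iff[THEN iffD2])
  hence "\<phi> \<in> polynomials n (2 - 1)" by simp
  moreover have "\<bar>f x - \<phi> x\<bar> \<le> M" if "x \<in> K" for x
  proof -
    have "\<phi> x = c / b - l x / b"
      by (simp add: \<phi>_def l_def sum_negf sum_divide_distrib)
    hence "f x - \<phi> x = (g x - c) / b" using b by (simp add: g_def field_simps)
    hence "\<bar>f x - \<phi> x\<bar> = \<bar>g x - c\<bar> / b" using b by simp
    also have "\<bar>g x - c\<bar> \<le> b * M" using c1[OF that] c2[OF that] by linarith
    hence "\<bar>g x - c\<bar> / b \<le> M" using b by (simp add: pos_divide_le_eq mult.commute)
    finally show ?thesis .
  qed
  hence "(SUP x\<in>K. ereal \<bar>f x - \<phi> x\<bar>) \<le> ereal M" by (intro SUP_least) simp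
  ultimately show ?thesis unfolding best_approx_def by (rule INF_lower2[of \<phi>])
qed

section \<open>Entropy on a product of simplices and the lower bound\<close>

text \<open>
  The contribution of a probability \<open>t\<close> to the Shannon entropy in bits. At \<open>t = 0\<close> the formula
  yields \<open>0\<close>, which is the continuous extension.
\<close>

definition entropy_term :: "real \<Rightarrow> real" where
  "entropy_term t = - (t * log 2 t)"

lemma entropy_term_simps [simp]: "entropy_term 0 = 0" "entropy_term 1 = 0"
  by (simp_all add: entropy_term_def)

text \<open>
  The expression is twice a summand of the Jensen--Shannon divergence. The lower bound is
  concavity, obtained from \<open>ln u \<le> u - 1\<close>. For the upper bound, \<open>log 2 a\<close> and \<open>log 2 b\<close> are
  replaced by \<open>log 2 (a + b)\<close>; halving the argument then contributes exactly \<open>a + b\<close> bits.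
\<close>

lemma entropy_term_midpoint:
  assumes "a \<ge> 0" "b \<ge> 0"
  shows "0 \<le> 2 * entropy_term ((a + b) / 2) - entropy_term a - entropy_term b"
    and "2 * entropy_term ((a + b) / 2) - entropy_term a - entropy_term b \<le> a + b"
proof -
  have "0 \<le> 2 * entropy_term ((a + b) / 2) - entropy_term a - entropy_term b \<and>
        2 * entropy_term ((a + b) / 2) - entropy_term a - entropy_term b \<le> a + b"
  proof (cases "a + b = 0")
    case True
    hence "a = 0" "b = 0" using assms by auto
    thus ?thesis by simp
  next
    case False
    define s where "s = a + b"
    have s: "s > 0" using False assms by (simp add: s_def)
    have le: "x * log 2 x \<le> x * log 2 s" if "0 \<le> x" "x \<le> s" for x
      using that by (cases "x = 0") (auto intro!: mult_left_mono)
    have ge: "x * log 2 (s / 2) - x * log 2 x \<le> (s / 2 - x) / ln 2" if "0 \<le> x" for x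
    proof (cases "x = 0")
      case True
      thus ?thesis using s by simp
    next
      case False
      hence x: "x > 0" using that by simp
      have "x * ln (s / 2 / x) \<le> x * (s / 2 / x - 1)"
        using x s by (intro mult_left_mono ln_le_minus_one) auto
      also have "\<dots> = s / 2 - x" using x by (simp add: field_simps)
      finally have "(x * ln (s / 2) - x * ln x) / ln 2 \<le> (s / 2 - x) / ln 2"
        using x s ln_div[of "s / 2" x] by (intro divide_right_mono) (simp_all add: right_diff_distrib)
      thus ?thesis by (simp add: log_def diff_divide_distrib)
    qed
    have mid: "2 * entropy_term (s / 2) = s - s * log 2 s"
      using s by (simp add: entropy_term_def log_divide algebra_simps)
    have "(s / 2 - a) / ln 2 + (s / 2 - b) / ln 2 = 0"
      by (simp add: s_def diff_divide_distrib add_divide_distrib)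
    hence "a * log 2 (s / 2) + b * log 2 (s / 2) \<le> a * log 2 a + b * log 2 b"
      using ge[OF assms(1)] ge[OF assms(2)] by linarith
    hence "0 \<le> 2 * entropy_term (s / 2) - entropy_term a - entropy_term b"
      by (simp add: entropy_term_def s_def algebra_simps)
    moreover have "2 * entropy_term (s / 2) - entropy_term a - entropy_term b \<le> s"
    proof -
      have "a * log 2 a + b * log 2 b \<le> a * log 2 s + b * log 2 s"
        using assms by (intro add_mono le) (auto simp: s_def)
      thus ?thesis unfolding mid by (simp add: entropy_term_def s_def algebra_simps)
    qed
    ultimately show ?thesis by (simp add: s_def)
  qed
  thus "0 \<le> 2 * entropy_term ((a + b) / 2) - entropy_term a - entropy_term b"
    "2 * entropy_term ((a + b) / 2) - entropy_term a - entropy_term b \<le> a + b" by auto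
qed

lemma continuous_on_entropy_term: "continuous_on {0..} entropy_term"
  unfolding continuous_on
proof
  fix t :: real assume "t \<in> {0..}"
  show "(entropy_term \<longlongrightarrow> entropy_term t) (at t within {0..})"
  proof (cases "t = 0")
    case True
    have "((\<lambda>t. - (t * log 2 t)) \<longlongrightarrow> 0) (at_right 0)" by real_asymp
    thus ?thesis using True unfolding entropy_term_def by (simp add: at_within_Ici_at_right)
  next
    case False
    hence "isCont entropy_term t"
      unfolding entropy_term_def using \<open>t \<in> {0..}\<close> by (auto intro!: continuous_intros)
    thus ?thesis by (metis continuous_at_imp_continuous_at_within continuous_within)
  qed
qed

text \<open>
  The \<open>m\<close> coordinates \<open>x k, \<dots>, x (k + m - 1)\<close> are read as a point of an \<open>m\<close>-dimensional simplex
  with \<open>m + 1\<close> barycentric coordinates, the last of which is determined by the others. The offset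
  \<open>k\<close> selects one of the two factors of a product of simplices.
\<close>

definition bary_coord :: "nat \<Rightarrow> nat \<Rightarrow> (nat \<Rightarrow> real) \<Rightarrow> nat \<Rightarrow> real" where
  "bary_coord m k x j = (if j < m then x (k + j) else 1 - (\<Sum>i<m. x (k + i)))"

lemma sum_bary_coord: "(\<Sum>j\<le>m. bary_coord m k x j) = 1"
proof -
  have "(\<Sum>j\<le>m. bary_coord m k x j) = (\<Sum>j<m. bary_coord m k x j) + bary_coord m k x m"
    by (simp add: lessThan_Suc_atMost[symmetric])
  thus ?thesis by (simp add: bary_coord_def)
qed

lemma bary_coord_affine:
  assumes "u + v = 1"
  shows "bary_coord m k (\<lambda>i. u * x i + v * y i) j = u * bary_coord m k x j + v * bary_coord m k y j"
proof -
  have v: "v = 1 - u" using assms by simp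
  show ?thesis
    by (simp add: bary_coord_def v sum.distrib sum_distrib_left[symmetric])
       (simp add: algebra_simps)
qed

lemma bary_coord_midpoint:
  "bary_coord m k (\<lambda>i. (x i + y i) / 2) j = (bary_coord m k x j + bary_coord m k y j) / 2"
  using bary_coord_affine[of "1/2" "1/2" m k x y j] by (simp add: add_divide_distrib)

definition entropy :: "nat \<Rightarrow> nat \<Rightarrow> (nat \<Rightarrow> real) \<Rightarrow> real" where
  "entropy m k x = (\<Sum>j\<le>m. entropy_term (bary_coord m k x j))"

definition simplex_product :: "nat \<Rightarrow> (nat \<Rightarrow> real) set" where
  "simplex_product m = {x. (\<forall>i\<ge>2 * m. x i = 0) \<and>
     (\<forall>j\<le>m. 0 \<le> bary_coord m 0 x j \<and> 0 \<le> bary_coord m m x j)}"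

text \<open>
  Summing over the barycentric coordinates, which have total \<open>1\<close> for each of \<open>x\<close> and \<open>y\<close>: the
  Jensen--Shannon divergence of two distributions lies between \<open>0\<close> and \<open>1\<close> bit.
\<close>

lemma entropy_midpoint:
  assumes "\<And>j. j \<le> m \<Longrightarrow> 0 \<le> bary_coord m k x j" "\<And>j. j \<le> m \<Longrightarrow> 0 \<le> bary_coord m k y j"
  shows "0 \<le> 2 * entropy m k (\<lambda>i. (x i + y i) / 2) - entropy m k x - entropy m k y"
    and "2 * entropy m k (\<lambda>i. (x i + y i) / 2) - entropy m k x - entropy m k y \<le> 2"
proof -
  let ?d = "\<lambda>j. 2 * entropy_term ((bary_coord m k x j + bary_coord m k y j) / 2)
               - entropy_term (bary_coord m k x j) - entropy_term (bary_coord m k y j)"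
  have eq: "2 * entropy m k (\<lambda>i. (x i + y i) / 2) - entropy m k x - entropy m k y = (\<Sum>j\<le>m. ?d j)"
    by (simp add: entropy_def bary_coord_midpoint sum_subtractf sum_distrib_left)
  show "0 \<le> 2 * entropy m k (\<lambda>i. (x i + y i) / 2) - entropy m k x - entropy m k y"
    unfolding eq using assms by (intro sum_nonneg entropy_term_midpoint) auto
  have "(\<Sum>j\<le>m. ?d j) \<le> (\<Sum>j\<le>m. bary_coord m k x j + bary_coord m k y j)"
    using assms by (intro sum_mono entropy_term_midpoint) auto
  thus "2 * entropy m k (\<lambda>i. (x i + y i) / 2) - entropy m k x - entropy m k y \<le> 2"
    unfolding eq by (simp add: sum.distrib sum_bary_coord)
qed

lemma continuous_on_bary_coord: "continuous_on S (\<lambda>x. bary_coord m k x j)"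
  unfolding bary_coord_def
  by (cases "j < m") (auto intro!: continuous_intros continuous_on_subset[OF continuous_on_product_coordinates])

lemma continuous_on_entropy:
  assumes "\<And>x j. x \<in> S \<Longrightarrow> j \<le> m \<Longrightarrow> 0 \<le> bary_coord m k x j"
  shows "continuous_on S (entropy m k)"
  unfolding entropy_def
  using assms by (intro continuous_on_sum continuous_on_compose2[OF continuous_on_entropy_term continuous_on_bary_coord]) auto

lemma simplex_product_subset:
  assumes "2 * m \<le> n"
  shows "simplex_product m \<subseteq> topspace (Euclidean_space n)"
  using assms by (auto simp: simplex_product_def topspace_Euclidean_space)

lemma simplex_product_convex_body:
  assumes "2 * m \<le> n"
  shows "closedin (Euclidean_space n) (simplex_product m)" "bounded_in n (simplex_product m)"
    "convex_in n (simplex_product m)"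
proof -
  note sub = simplex_product_subset[OF assms]
  have "simplex_product m = (\<Inter>i\<in>{2 * m..}. {x. x i = 0}) \<inter>
      (\<Inter>j\<in>{..m}. {x. 0 \<le> bary_coord m 0 x j} \<inter> {x. 0 \<le> bary_coord m m x j})"
    by (auto simp: simplex_product_def)
  moreover have "closed \<dots>"
    by (intro closed_Int closed_INT closed_Collect_eq closed_Collect_le ballI
        continuous_on_const continuous_on_bary_coord continuous_on_product_coordinates)
  ultimately show "closedin (Euclidean_space n) (simplex_product m)"
    using closedin_Euclidean_space_iff[OF sub] by simp
  show "convex_in n (simplex_product m)"
    unfolding convex_in_def using sub by (auto simp: simplex_product_def bary_coord_affine)
  have "L2_set x {..<n} \<le> real n" if x: "x \<in> simplex_product m" for x
  proof -
    have le1: "bary_coord m k x j \<le> 1" if "k = 0 \<or> k = m" "j \<le> m" for k j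
    proof -
      have "bary_coord m k x j \<le> (\<Sum>j\<le>m. bary_coord m k x j)"
        using x that by (intro member_le_sum) (auto simp: simplex_product_def)
      thus ?thesis by (simp add: sum_bary_coord)
    qed
    have "\<bar>x i\<bar> \<le> 1" for i
    proof -
      consider "i < m" | "m \<le> i" "i < 2 * m" | "2 * m \<le> i" by linarith
      thus ?thesis
      proof cases
        case 1
        hence "x i = bary_coord m 0 x i" by (simp add: bary_coord_def)
        thus ?thesis using le1[of 0 i] x 1 by (auto simp: simplex_product_def)
      next
        case 2
        hence "x i = bary_coord m m x (i - m)" by (simp add: bary_coord_def)
        moreover have "i - m \<le> m" using 2 by linarith
        ultimately show ?thesis using le1[of m "i - m"] x by (auto simp: simplex_product_def)
      next
        case 3
        thus ?thesis using x by (simp add: simplex_product_def)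
      qed
    qed
    hence "(\<Sum>i<n. \<bar>x i\<bar>) \<le> (\<Sum>i<n. 1)" by (intro sum_mono)
    thus ?thesis using L2_set_le_sum_abs[of x "{..<n}"] by simp
  qed
  thus "bounded_in n (simplex_product m)" unfolding bounded_in_def using sub by blast
qed

lemma entropy_vertex:
  assumes "\<And>j. j \<le> m \<Longrightarrow> bary_coord m k x j = (if j = i then 1 else 0)"
  shows "entropy m k x = 0"
  unfolding entropy_def using assms by (intro sum.neutral) auto

lemma entropy_centre:
  assumes "\<And>j. j \<le> m \<Longrightarrow> bary_coord m k x j = 1 / (real m + 1)"
  shows "entropy m k x = log 2 (real m + 1)"
proof -
  have "entropy m k x = (\<Sum>j\<le>m. entropy_term (1 / (real m + 1)))"
    unfolding entropy_def using assms by (intro sum.cong) auto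
  also have "\<dots> = log 2 (real m + 1)" by (simp add: entropy_term_def log_divide add.commute)
  finally show ?thesis .
qed

text \<open>
  The extremal function. The entropies of the two factors enter with opposite signs: each
  second difference is then the difference of two numbers in \<open>[0, 1]\<close>, while the function deviates
  from being affine in both directions. The factor \<open>1/2\<close> normalizes the modulus to \<open>1\<close>.
\<close>

definition entropy_gap :: "nat \<Rightarrow> (nat \<Rightarrow> real) \<Rightarrow> real" where
  "entropy_gap m x = (entropy m 0 x - entropy m m x) / 2"

text \<open>
  The pairs (centre of the first simplex, vertex \<open>j\<close> of the second one); \<open>j = m\<close> is the vertex at
  the origin.
\<close>

definition centre_vertex :: "nat \<Rightarrow> nat \<Rightarrow> nat \<Rightarrow> real" where
  "centre_vertex m j i = (if i < m then 1 / (real m + 1) else if i = m + j \<and> j < m then 1 else 0)"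

definition vertex_centre :: "nat \<Rightarrow> nat \<Rightarrow> nat \<Rightarrow> real" where
  "vertex_centre m j i = (if i < m then (if i = j then 1 else 0) else if i < 2 * m then 1 / (real m + 1) else 0)"

lemma bary_coord_centre_vertex:
  assumes "j \<le> m" "i \<le> m"
  shows "bary_coord m 0 (centre_vertex m j) i = 1 / (real m + 1)"
    "bary_coord m m (centre_vertex m j) i = (if i = j then 1 else 0)"
  using assms
  by (auto simp: bary_coord_def centre_vertex_def field_simps)

lemma bary_coord_vertex_centre:
  assumes "j \<le> m" "i \<le> m"
  shows "bary_coord m 0 (vertex_centre m j) i = (if i = j then 1 else 0)"
    "bary_coord m m (vertex_centre m j) i = 1 / (real m + 1)"
  using assms
  by (auto simp: bary_coord_def vertex_centre_def field_simps)

lemma entropy_gap_values: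
  assumes "j \<le> m"
  shows "entropy_gap m (centre_vertex m j) = 1 / 2 * log 2 (real m + 1)"
    "entropy_gap m (vertex_centre m j) = - (1 / 2 * log 2 (real m + 1))"
proof -
  have "entropy m 0 (centre_vertex m j) = log 2 (real m + 1)" "entropy m m (vertex_centre m j) = log 2 (real m + 1)"
    using assms by (intro entropy_centre; simp add: bary_coord_centre_vertex bary_coord_vertex_centre)+
  moreover have "entropy m m (centre_vertex m j) = 0" "entropy m 0 (vertex_centre m j) = 0"
    using assms by (intro entropy_vertex[where i = j]; simp add: bary_coord_centre_vertex bary_coord_vertex_centre)+
  ultimately show "entropy_gap m (centre_vertex m j) = 1 / 2 * log 2 (real m + 1)"
    "entropy_gap m (vertex_centre m j) = - (1 / 2 * log 2 (real m + 1))"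
    by (simp_all add: entropy_gap_def)
qed

lemma vertices_in_simplex_product:
  assumes "j \<le> m"
  shows "centre_vertex m j \<in> simplex_product m" "vertex_centre m j \<in> simplex_product m"
proof -
  show "centre_vertex m j \<in> simplex_product m"
    using assms unfolding simplex_product_def
    by (simp add: bary_coord_centre_vertex) (simp add: centre_vertex_def)
  show "vertex_centre m j \<in> simplex_product m"
    using assms unfolding simplex_product_def
    by (simp add: bary_coord_vertex_centre) (simp add: vertex_centre_def)
qed

text \<open>
  Both families average to the pair of centres. An affine function therefore has the same
  average over both, whereas \<^const>\<open>entropy_gap\<close> is constant on each of them with opposite values.
\<close>

lemma sum_vertices: "(\<Sum>j\<le>m. centre_vertex m j i) = (\<Sum>j\<le>m. vertex_centre m j i)"
proof -
  consider "i < m" | "m \<le> i" "i < 2 * m" | "2 * m \<le> i" by linarith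
  thus ?thesis
  proof cases
    case 1
    thus ?thesis by (simp add: centre_vertex_def vertex_centre_def)
  next
    case 2
    have "(\<Sum>j\<le>m. centre_vertex m j i) = (\<Sum>j\<le>m. if j = i - m then 1 else 0)"
      using 2 by (intro sum.cong) (auto simp: centre_vertex_def)
    also have "\<dots> = 1" using 2 by simp
    finally show ?thesis using 2 by (simp add: vertex_centre_def)
  next
    case 3
    have "centre_vertex m j i = 0" if "j \<le> m" for j using 3 by (auto simp: centre_vertex_def)
    thus ?thesis using 3 by (simp add: vertex_centre_def)
  qed
qed

text \<open>
  If an affine \<open>\<phi>\<close> were closer to \<^const>\<open>entropy_gap\<close> than \<open>L\<close>, it would be positive on the family on
  which that function is \<open>L\<close> and negative on the one on which it is \<open>- L\<close>, contradicting the equality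
  of the averages.
\<close>

lemma whitney_const_lower:
  assumes "2 * m \<le> n"
  shows "ereal (1 / 2 * log 2 (real m + 1)) \<le> whitney_const 2 n"
proof -
  let ?K = "simplex_product m" and ?f = "entropy_gap m" and ?L = "1 / 2 * log 2 (real m + 1)"
  note body = simplex_product_convex_body[OF assms]
  have "modulus n 2 ?f ?K \<le> ereal 1"
    unfolding modulus_2_le_iff[OF body(3)]
  proof (intro ballI)
    fix x y assume "x \<in> ?K" "y \<in> ?K"
    hence "\<And>j. j \<le> m \<Longrightarrow> 0 \<le> bary_coord m k x j" "\<And>j. j \<le> m \<Longrightarrow> 0 \<le> bary_coord m k y j" if "k \<in> {0, m}" for k
      using that by (auto simp: simplex_product_def)
    note mid = entropy_midpoint[OF this]
    show "\<bar>?f x + ?f y - 2 * ?f (\<lambda>i. (x i + y i) / 2)\<bar> \<le> 1"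
      using mid[of 0] mid[of m] by (simp add: entropy_gap_def abs_le_iff field_simps)
  qed
  moreover have "continuous_on ?K ?f"
    unfolding entropy_gap_def
    by (intro continuous_intros continuous_on_entropy) (auto simp: simplex_product_def)
  hence "continuous_map (subtopology (Euclidean_space n) ?K) euclideanreal ?f"
    using continuous_map_Euclidean_space_iff[OF simplex_product_subset[OF assms]] by simp
  ultimately have f: "?f \<in> {f. continuous_map (subtopology (Euclidean_space n) ?K) euclideanreal f \<and> modulus n 2 f ?K \<le> 1}"
    by (simp add: one_ereal_def)
  have "ereal ?L \<le> best_approx n 2 ?f ?K"
    unfolding best_approx_def
  proof (rule INF_greatest)
    fix \<phi> assume "\<phi> \<in> polynomials n (2 - 1)"
    then obtain c a where \<phi>: "\<And>x. \<phi> x = c + (\<Sum>i<n. a i * x i)"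
      using polynomials_1_iff[of \<phi> n] by auto
    have sum_\<phi>: "(\<Sum>j\<le>m. \<phi> (p j)) = (real m + 1) * c + (\<Sum>i<n. a i * (\<Sum>j\<le>m. p j i))" for p
      unfolding \<phi> sum_distrib_left by (simp add: sum.distrib add.commute) (rule sum.swap)
    have "\<exists>x\<in>?K. ?L \<le> \<bar>?f x - \<phi> x\<bar>"
    proof (rule ccontr)
      assume "\<not> ?thesis"
      hence less: "\<And>x. x \<in> ?K \<Longrightarrow> \<bar>?f x - \<phi> x\<bar> < ?L" by force
      have "\<phi> (centre_vertex m j) > 0" if "j \<le> m" for j
        using less[OF vertices_in_simplex_product(1)[OF that]] entropy_gap_values(1)[OF that] by linarith
      hence "(\<Sum>j\<le>m. \<phi> (centre_vertex m j)) > 0" by (intro sum_pos) auto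
      moreover have "\<phi> (vertex_centre m j) < 0" if "j \<le> m" for j
        using less[OF vertices_in_simplex_product(2)[OF that]] entropy_gap_values(2)[OF that] by linarith
      hence "(\<Sum>j\<le>m. - \<phi> (vertex_centre m j)) > 0" by (intro sum_pos) auto
      ultimately show False by (simp add: sum_negf sum_\<phi> sum_vertices)
    qed
    then obtain x where "x \<in> ?K" "?L \<le> \<bar>?f x - \<phi> x\<bar>" by blast
    thus "ereal ?L \<le> (SUP x\<in>?K. ereal \<bar>?f x - \<phi> x\<bar>)" by (intro SUP_upper2[of x]) auto
  qed
  also have "\<dots> \<le> whitney_const_on n 2 ?K"
    unfolding whitney_const_on_def using f by (rule SUP_upper)
  also have "\<dots> \<le> whitney_const 2 n"
    unfolding whitney_const_def using body vertices_in_simplex_product[of 0 m]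
    by (intro SUP_upper) auto
  finally show ?thesis .
qed

section \<open>Both bounds and the limit\<close>

lemma whitney_const_upper:
  assumes "n \<ge> 1" "1 / 2 + 1 / 2 * log 2 n < M"
  shows "whitney_const 2 n \<le> ereal M"
  unfolding whitney_const_def whitney_const_on_def
  using best_approx_upper[OF _ _ _ _ assms(1) _ _ assms(2)] by (intro SUP_least) auto

theorem theorem3p1:
  shows "(\<forall>n::nat. n \<ge> 2 \<longrightarrow>
            ereal (1 / 2 * log 2 (real_of_int \<lfloor>real n / 2\<rfloor> + 1)) \<le> whitney_const 2 n \<and>
            whitney_const 2 n \<le> ereal (1 / 2 * real_of_int \<lfloor>log 2 (real n)\<rfloor> + 5 / 4)) \<and>
         ((\<lambda>n::nat. whitney_const 2 n / ereal (log 2 (real n))) \<longlonglongrightarrow> ereal (1 / 2))"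
proof (intro conjI allI impI)
  fix n :: nat assume n: "n \<ge> 2"
  have "\<lfloor>real n / 2\<rfloor> = int (n div 2)" using floor_divide_of_nat_eq[of n 2] by simp
  thus "ereal (1 / 2 * log 2 (real_of_int \<lfloor>real n / 2\<rfloor> + 1)) \<le> whitney_const 2 n"
    using whitney_const_lower[of "n div 2" n] by simp
  have "1 / 2 + 1 / 2 * log 2 n < 1 / 2 * real_of_int \<lfloor>log 2 (real n)\<rfloor> + 5 / 4" by linarith
  thus "whitney_const 2 n \<le> ereal (1 / 2 * real_of_int \<lfloor>log 2 (real n)\<rfloor> + 5 / 4)"
    using n by (intro whitney_const_upper) auto
next
  have quotient: "ereal a / ereal (log 2 (real n)) = ereal (a / log 2 (real n))" if "n \<ge> 2" for a :: real and n :: nat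
  proof -
    have "log 2 (real n) > 0" using that by simp
    thus ?thesis by (metis ereal_divide less_irrefl)
  qed
  show "(\<lambda>n::nat. whitney_const 2 n / ereal (log 2 (real n))) \<longlonglongrightarrow> ereal (1 / 2)"
  proof (rule tendsto_sandwich)
    have "(\<lambda>n::nat. (1 / 2 * log 2 (real n) - 1 / 2) / log 2 (real n)) \<longlonglongrightarrow> 1 / 2" by real_asymp
    thus "(\<lambda>n::nat. ereal ((1 / 2 * log 2 (real n) - 1 / 2) / log 2 (real n))) \<longlonglongrightarrow> ereal (1 / 2)" by simp
    have "(\<lambda>n::nat. (1 / 2 * log 2 (real n) + 1) / log 2 (real n)) \<longlonglongrightarrow> 1 / 2" by real_asymp
    thus "(\<lambda>n::nat. ereal ((1 / 2 * log 2 (real n) + 1) / log 2 (real n))) \<longlonglongrightarrow> ereal (1 / 2)" by simp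
    show "\<forall>\<^sub>F n in sequentially.
        ereal ((1 / 2 * log 2 (real n) - 1 / 2) / log 2 (real n)) \<le> whitney_const 2 n / ereal (log 2 (real n))"
      using eventually_ge_at_top[of "2::nat"]
    proof eventually_elim
      case (elim n)
      have "log 2 (real n / 2) \<le> log 2 (real (n div 2) + 1)"
        using elim by (subst log_le_cancel_iff) auto
      hence "1 / 2 * log 2 (real n) - 1 / 2 \<le> 1 / 2 * log 2 (real (n div 2) + 1)"
        using elim by (simp add: log_divide)
      also have "ereal \<dots> \<le> whitney_const 2 n" by (rule whitney_const_lower) simp
      finally have "ereal (1 / 2 * log 2 (real n) - 1 / 2) / ereal (log 2 (real n)) \<le> whitney_const 2 n / ereal (log 2 (real n))"
        using elim by (intro ereal_divide_right_mono) auto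
      thus ?case unfolding quotient[OF elim] .
    qed
    show "\<forall>\<^sub>F n in sequentially.
        whitney_const 2 n / ereal (log 2 (real n)) \<le> ereal ((1 / 2 * log 2 (real n) + 1) / log 2 (real n))"
      using eventually_ge_at_top[of "2::nat"]
    proof eventually_elim
      case (elim n)
      have "whitney_const 2 n \<le> ereal (1 / 2 * log 2 (real n) + 1)"
        using elim by (intro whitney_const_upper) auto
      hence "whitney_const 2 n / ereal (log 2 (real n)) \<le> ereal (1 / 2 * log 2 (real n) + 1) / ereal (log 2 (real n))"
        using elim by (intro ereal_divide_right_mono) auto
      thus ?case unfolding quotient[OF elim] .
    qed
  qed
qed

end
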